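(* Let $(M,G)$ be a proper $G$-manifold and write $M$ as the disjoint union of its orbit-type strata $\{M_\beta \mid \beta\in\mathcal{B}\}$. Let $\mathcal{B}'$ be the biggest subset of $\mathcal{B}$ such that $M_\beta$ is a minimal orbit-type stratum for every $\beta\in\mathcal{B}'$. Then $$\mathrm{Cat}_G(M)\;\geq\;\sum_{\beta\in\mathcal{B}'}\mathrm{Cat}_G(M_\beta).$$
   Context: A proper $G$-manifold $(M,G)$ is a smooth manifold $M$ with a smooth proper action of a Lie group $G$. Write $G_m$ for the stabilizer of $m\in M$ and $G\cdot m$ for its orbit. Equivariant LS-category. For $G$-invariant subsets $B\subset A$ of $M$, a $G$-deformation retract of $A$ onto $B$ is a homotopy $H:A\times[0,1]\to A$, $H_t(a)=H(a,t)$, with $H(g\cdot a,t)=g\cdot H(a,t)$ for all $g\in G$, $a\in A$, $t\in[0,1]$, such that $H_0(a)=a$ and $H_1(a)\in B$ for all $a\in A$, and $H(b,1)=b$ for all $b\in B$. A $G$-invariant subset $U$ is $G$-categorical if there is a $G$-deformation retract of $U$ onto the orbit $G\cdot x$ of some $x\in U$. $\mathrm{Cat}_G(M)$ is the least number of $G$-categorical open subsets of $M$ required to cover $M$ ($\infty$ if no such cover exists). $\mathrm{Cat}_G(M_\beta)$ is defined in the same way for the $G$-space $M_\beta$ with the subset topology. Orbit-type strata (modified definition). For a closed subgroup $H\subset G$ let $(H)$ be its conjugacy class and $M_H=\{m\in M\mid G_m=H\}$, and write $M_H=\coprod_{b\in\mathcal{B}_H}M_{H,b}$ as the disjoint union of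 its connected components. For $b\in\mathcal{B}_H$, $(b)$ denotes the set of $a\in\mathcal{B}_H$ with $G\cdot M_{H,a}=G\cdot M_{H,b}$. $\mathcal{B}$ is the set of pairs $\beta=((H),(b))$, and the orbit-type stratum $M_\beta$ is $G\cdot M_{H,b}$ (it need not be connected). Distinct indices correspond to distinct strata, and $M$ is the disjoint union of the $M_\beta$, $\beta\in\mathcal{B}$. The strict partial order on $\mathcal{B}$ is: $\alpha\prec\beta$ if and only if $\alpha\neq\beta$ and $M_\alpha\cap\overline{M_\beta}\neq\varnothing$. A stratum $M_\beta$ is minimal if there is no $\alpha\in\mathcal{B}$ with $\alpha\prec\beta$. *)

theory Defs
  imports "HOL-Analysis.Analysis" "HOL-Algebra.Group_Action"
begin

section \<open>Smooth manifolds\<close>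

text \<open>
  The model space of a manifold is a linear subspace V of a Euclidean type, so that the dimension
  dim V is an arbitrary natural number. A Euclidean type itself has positive dimension, and
  taking the whole type as model would exclude discrete Lie groups.

  For f on a relatively open subset S of V, \<open>C_diff V k S f\<close> says that f is of class C^k.
  The derivative \<open>f' x\<close> is determined on V only, hence the restriction to directions in V.
\<close>

primrec C_diff ::
  "'e::euclidean_space set \<Rightarrow> nat \<Rightarrow> 'e set \<Rightarrow> ('e \<Rightarrow> 'f::euclidean_space) \<Rightarrow> bool" where
  "C_diff V 0 S f \<longleftrightarrow> continuous_on S f"
| "C_diff V (Suc k) S f \<longleftrightarrow>
     (\<exists>f'. (\<forall>x\<in>S. (f has_derivative f' x) (at x within S)) \<and>
           (\<forall>v\<in>V. C_diff V k S (\<lambda>x. f' x v)))"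

definition smooth_on ::
  "'e::euclidean_space set \<Rightarrow> 'e set \<Rightarrow> ('e \<Rightarrow> 'f::euclidean_space) \<Rightarrow> bool" where
  "smooth_on V S f \<longleftrightarrow> (\<forall>k. C_diff V k S f)"

type_synonym ('m, 'e) chart = "'m set \<times> ('m \<Rightarrow> 'e)"

text \<open>The atlas need not be maximal; it only serves to determine the smooth structure.\<close>

locale smooth_manifold =
  fixes V :: "'e::euclidean_space set"
    and X :: "'m topology"
    and \<A> :: "('m, 'e) chart set"
  assumes model_subspace: "subspace V"
    and Hausdorff: "Hausdorff_space X"
    and second_countable: "second_countable X"
    and chart_domain: "(U, c) \<in> \<A> \<Longrightarrow> openin X U"
    and chart_image: "(U, c) \<in> \<A> \<Longrightarrow> openin (top_of_set V) (c ` U)"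
    and chart_homeomorphic:
      "(U, c) \<in> \<A> \<Longrightarrow> homeomorphic_map (subtopology X U) (top_of_set (c ` U)) c"
    and charts_cover: "(\<Union>(U, c)\<in>\<A>. U) = topspace X"
    and charts_compatible:
      "(U, c) \<in> \<A> \<Longrightarrow> (U', c') \<in> \<A> \<Longrightarrow> smooth_on V (c ` (U \<inter> U')) (c' \<circ> inv_into U c)"

definition product_atlas ::
  "('m, 'e) chart set \<Rightarrow> ('n, 'f) chart set \<Rightarrow> ('m \<times> 'n, 'e \<times> 'f) chart set" where
  "product_atlas \<A> \<B> = {(U \<times> U', map_prod c c') | U c U' c'. (U, c) \<in> \<A> \<and> (U', c') \<in> \<B>}"

definition smooth_map ::
  "'e::euclidean_space set \<Rightarrow> 'm topology \<Rightarrow> ('m, 'e) chart set \<Rightarrow>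
   'n topology \<Rightarrow> ('n, 'f::euclidean_space) chart set \<Rightarrow> ('m \<Rightarrow> 'n) \<Rightarrow> bool" where
  "smooth_map V X \<A> Y \<B> F \<longleftrightarrow>
     continuous_map X Y F \<and>
     (\<forall>(U, c)\<in>\<A>. \<forall>(U', c')\<in>\<B>. smooth_on V (c ` (U \<inter> F -` U')) (c' \<circ> F \<circ> inv_into U c))"

section \<open>Lie groups and proper actions\<close>

locale lie_group = smooth_manifold V X \<A> + group G
  for V :: "'e::euclidean_space set" and X :: "'g topology" and \<A> :: "('g, 'e) chart set"
    and G :: "('g, 'r) monoid_scheme" (structure) +
  assumes topspace_carrier: "topspace X = carrier G"
    and smooth_mult:
      "smooth_map (V \<times> V) (prod_topology X X) (product_atlas \<A> \<A>) X \<A> (\<lambda>(g, h). g \<otimes> h)"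
    and smooth_inverse: "smooth_map V X \<A> X \<A> (\<lambda>g. inv g)"

locale proper_G_manifold =
  lie_group VG XG \<A>G G + smooth_manifold VM XM \<A>M + group_action G "topspace XM" \<phi>
  for VG :: "'e::euclidean_space set" and XG :: "'g topology" and \<A>G :: "('g, 'e) chart set"
    and G :: "('g, 'r) monoid_scheme" (structure)
    and VM :: "'f::euclidean_space set" and XM :: "'m topology" and \<A>M :: "('m, 'f) chart set"
    and \<phi> :: "'g \<Rightarrow> 'm \<Rightarrow> 'm" +
  assumes smooth_action:
      "smooth_map (VG \<times> VM) (prod_topology XG XM) (product_atlas \<A>G \<A>M) XM \<A>M
         (\<lambda>(g, m). \<phi> g m)"
    and proper_action:
      "proper_map (prod_topology XG XM) (prod_topology XM XM) (\<lambda>(g, m). (\<phi> g m, m))"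

section \<open>Equivariant LS-category\<close>

definition G_invariant :: "('g, 'r) monoid_scheme \<Rightarrow> ('g \<Rightarrow> 'm \<Rightarrow> 'm) \<Rightarrow> 'm set \<Rightarrow> bool" where
  "G_invariant G \<phi> A \<longleftrightarrow> (\<forall>g\<in>carrier G. \<forall>a\<in>A. \<phi> g a \<in> A)"

definition G_deformation_retract ::
  "('g, 'r) monoid_scheme \<Rightarrow> ('g \<Rightarrow> 'm \<Rightarrow> 'm) \<Rightarrow> 'm topology \<Rightarrow> 'm set \<Rightarrow> 'm set \<Rightarrow>
   ('m \<times> real \<Rightarrow> 'm) \<Rightarrow> bool" where
  "G_deformation_retract G \<phi> X A B H \<longleftrightarrow>
     continuous_map (prod_topology (subtopology X A) (top_of_set {0..1})) (subtopology X A) H \<and>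
     (\<forall>g\<in>carrier G. \<forall>a\<in>A. \<forall>t\<in>{0..1}. H (\<phi> g a, t) = \<phi> g (H (a, t))) \<and>
     (\<forall>a\<in>A. H (a, 0) = a \<and> H (a, 1) \<in> B) \<and>
     (\<forall>b\<in>B. H (b, 1) = b)"

definition G_categorical ::
  "('g, 'r) monoid_scheme \<Rightarrow> ('g \<Rightarrow> 'm \<Rightarrow> 'm) \<Rightarrow> 'm topology \<Rightarrow> 'm set \<Rightarrow> bool" where
  "G_categorical G \<phi> X U \<longleftrightarrow>
     U \<subseteq> topspace X \<and> G_invariant G \<phi> U \<and>
     (\<exists>x\<in>U. \<exists>H. G_deformation_retract G \<phi> X U (orbit G \<phi> x) H)"

text \<open>
  The infimum of the empty set is \<infinity>, which is the value when there is no finite cover.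
\<close>

definition Cat_G ::
  "('g, 'r) monoid_scheme \<Rightarrow> ('g \<Rightarrow> 'm \<Rightarrow> 'm) \<Rightarrow> 'm topology \<Rightarrow> enat" where
  "Cat_G G \<phi> X =
     Inf {enat (card \<U>) | \<U>. finite \<U> \<and> (\<forall>U\<in>\<U>. openin X U \<and> G_categorical G \<phi> X U) \<and>
            \<Union>\<U> = topspace X}"

section \<open>Orbit-type strata\<close>

definition isotropy_set ::
  "('g, 'r) monoid_scheme \<Rightarrow> ('g \<Rightarrow> 'm \<Rightarrow> 'm) \<Rightarrow> 'm topology \<Rightarrow> 'g set \<Rightarrow> 'm set" where
  "isotropy_set G \<phi> X H = {m \<in> topspace X. stabilizer G \<phi> m = H}"

definition saturation ::
  "('g, 'r) monoid_scheme \<Rightarrow> ('g \<Rightarrow> 'm \<Rightarrow> 'm) \<Rightarrow> 'm set \<Rightarrow> 'm set" where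
  "saturation G \<phi> S = (\<Union>m\<in>S. orbit G \<phi> m)"

text \<open>
  The usual index of a stratum is the pair of the conjugacy class of H and the class of those
  components C of the isotropy set of H that have the same saturation. Distinct indices give
  distinct strata, so the set of strata serves as its own index set. In particular, replacing H by
  a conjugate, or C by a component with the same saturation, gives the same element.
\<close>

definition orbit_type_strata ::
  "('g, 'r) monoid_scheme \<Rightarrow> 'g topology \<Rightarrow> ('g \<Rightarrow> 'm \<Rightarrow> 'm) \<Rightarrow> 'm topology \<Rightarrow> 'm set set" where
  "orbit_type_strata G XG \<phi> X =
     {saturation G \<phi> C | H C. subgroup H G \<and> closedin XG H \<and>
        C \<in> connected_components_of (subtopology X (isotropy_set G \<phi> X H))}"

definition stratum_less :: "'m topology \<Rightarrow> 'm set \<Rightarrow> 'm set \<Rightarrow> bool" where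
  "stratum_less X S T \<longleftrightarrow> S \<noteq> T \<and> S \<inter> (X closure_of T) \<noteq> {}"

definition minimal_strata ::
  "('g, 'r) monoid_scheme \<Rightarrow> 'g topology \<Rightarrow> ('g \<Rightarrow> 'm \<Rightarrow> 'm) \<Rightarrow> 'm topology \<Rightarrow> 'm set set" where
  "minimal_strata G XG \<phi> X =
     {T \<in> orbit_type_strata G XG \<phi> X. \<not> (\<exists>S \<in> orbit_type_strata G XG \<phi> X. stratum_less X S T)}"

end

theory Submission
  imports Defs
begin

text \<open>
  Along an equivariant homotopy the stabilizer of a moving point contains the stabilizer of its
  starting point. The proof shows that a point of a stratum S that is closed in M can then never
  leave S. Minimal strata are closed, because the strata cover M and S is the only stratum that
  meets the closure of S. So if a G-categorical set U meets a minimal stratum S, its retraction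
  moves points of U \<inter> S inside S, hence the orbit onto which U retracts lies in S
  (\<open>center_in_stratum\<close>), and U \<inter> S is G-categorical in S by the same homotopy
  (\<open>categorical_restrict\<close>). Since distinct strata are disjoint, each member of a cover
  contributes to at most one minimal stratum, and counting gives the inequality.

  That a path cannot leave a closed stratum (\<open>path_stays_in_stratum\<close>) is an open-closed
  argument on the unit interval. Openness uses two facts about stabilizers. First, when a
  stabilizer contains another one from the same stratum, to which it is conjugate, the two are
  equal (\<open>stratum_stabilizers_eq\<close>). Second, a point close to m whose stabilizer contains the
  stabilizer of m has the same stabilizer as m (\<open>stabilizer_locally_maximal\<close>). These facts are
  usually read off from the slice theorem and from dimension and component counts for compact Lie
  groups. Here both follow from one property of closed subgroups L of a Lie group, a relative
  version of the absence of small subgroups (\<open>no_small_overgroups\<close>): L has a neighbourhood in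
  which L itself is the only subgroup containing L. The second fact then needs only that
  stabilizers are upper semicontinuous, by properness. For the first, the conjugates of a compact
  subgroup H by the powers of g form a descending chain if conjugation maps H into itself; by
  compactness the chain enters that neighbourhood of its intersection, so it is stationary.

  The neighbourhood property itself is proved in a chart, with no exponential map: the only
  analytic input is that multiplication by a small factor is, up to an error small relative to it,
  translation in the chart.
\<close>

section \<open>Multiplication is almost translation\<close>

text \<open>
  The map y \<mapsto> F (x, y) - (y - p) has derivative 0 at y = p when x = p, hence by continuity
  of the derivative a small one for (x, y) near (p, p), and the mean value inequality along the
  segment from p to y gives the estimate. Only the error relative to the second factor is small;
  this is what makes errors add up linearly when a small factor is multiplied repeatedly.
\<close>

lemma C1_translation_estimate:
  fixes F :: "'e \<times> 'e \<Rightarrow> 'e::euclidean_space"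
  assumes V: "subspace V"
    and S: "openin (top_of_set (V \<times> V)) S" and pS: "(p, p) \<in> S"
    and C1: "C_diff (V \<times> V) 1 S F"
    and unit: "\<And>y. (p, y) \<in> S \<Longrightarrow> F (p, y) = y" "\<And>x. (x, p) \<in> S \<Longrightarrow> F (x, p) = x"
    and "\<epsilon> > 0"
  obtains r where "r > 0"
    "\<And>x y. \<lbrakk>x \<in> V; y \<in> V; dist x p < r; dist y p < r\<rbrakk>
       \<Longrightarrow> (x, y) \<in> S \<and> norm (F (x, y) - x - (y - p)) \<le> \<epsilon> * norm (y - p)"
proof -
  have pV: "p \<in> V"
    using pS S openin_imp_subset by fastforce
  obtain F' where F': "\<And>z. z \<in> S \<Longrightarrow> (F has_derivative F' z) (at z within S)"
    and F'_cont: "\<And>v. v \<in> V \<times> V \<Longrightarrow> continuous_on S (\<lambda>z. F' z v)"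
    using C1 by auto
  obtain \<rho> where \<rho>: "\<rho> > 0" "\<And>z. z \<in> V \<times> V \<Longrightarrow> dist z (p, p) < \<rho> \<Longrightarrow> z \<in> S"
    using S pS unfolding openin_euclidean_subtopology_iff by (metis)
  have segment: "(p, p + t *\<^sub>R v) \<in> V \<times> V" if "v \<in> V" for t v
    using that pV V by (simp add: subspace_add subspace_scale)
  have F'_p: "F' (p, p) (0, v) = v" if v: "v \<in> V" for v
  proof -
    define T where "T = ball 0 (\<rho> / (1 + norm v)) \<inter> (UNIV :: real set)"
    have 0: "0 < \<rho> / (1 + norm v)"
      using \<rho>(1) by (simp add: add_pos_nonneg)
    have T: "open T" "0 \<in> T"
      using 0 by (auto simp: T_def)
    have TS: "(p, p + t *\<^sub>R v) \<in> S" if "t \<in> T" for t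
    proof (rule \<rho>(2)[OF segment[OF v]])
      have "\<bar>t\<bar> * norm v \<le> \<bar>t\<bar> * (1 + norm v)"
        by (simp add: mult_left_mono)
      also have "\<dots> < \<rho>"
        using that by (simp add: T_def pos_less_divide_eq add_pos_nonneg)
      finally show "dist (p, p + t *\<^sub>R v) (p, p) < \<rho>"
        by (simp add: dist_Pair_Pair dist_norm)
    qed
    have "((\<lambda>t. F (p, p + t *\<^sub>R v)) has_derivative (\<lambda>h. F' (p, p + 0 *\<^sub>R v) (0, h *\<^sub>R v))) (at 0 within T)"
    proof (rule has_derivative_in_compose2[where t = S and g = F and g' = F'])
      show "((\<lambda>t. (p, p + t *\<^sub>R v)) has_derivative (\<lambda>h. (0, h *\<^sub>R v))) (at 0 within T)"
        by (auto intro!: derivative_eq_intros)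
    next
      show "(\<lambda>t. (p, p + t *\<^sub>R v)) ` T \<subseteq> S"
        using TS by blast
    qed (use F' T(2) in \<open>blast+\<close>)
    then have "((\<lambda>t. F (p, p + t *\<^sub>R v)) has_derivative (\<lambda>h. F' (p, p) (0, h *\<^sub>R v))) (at 0)"
      by (simp only: at_within_open[OF T(2) T(1)] scaleR_zero_left add_0_right)
    moreover have "((\<lambda>t. F (p, p + t *\<^sub>R v)) has_derivative (\<lambda>h. h *\<^sub>R v)) (at 0)"
    proof (rule has_derivative_transform_within_open[OF _ T])
      show "((\<lambda>t. p + t *\<^sub>R v) has_derivative (\<lambda>h. h *\<^sub>R v)) (at 0)"
        by (auto intro!: derivative_eq_intros)
    qed (use TS unit in auto)
    ultimately have "(\<lambda>h. F' (p, p) (0, h *\<^sub>R v)) = (\<lambda>h. h *\<^sub>R v)"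
      by (rule has_derivative_unique)
    from fun_cong[OF this, of 1] show ?thesis by simp
  qed
  obtain B where B: "B \<subseteq> V" "pairwise orthogonal B" "\<And>b. b \<in> B \<Longrightarrow> norm b = 1"
      "independent B" "span B = V"
    using orthonormal_basis_subspace[OF V] by metis
  have "finite B"
    using B(4) independent_imp_finite by blast
  \<comment> \<open>Controls the operator norm of v \<mapsto> F' z (0, v) - v on V, and is continuous since B is finite.\<close>
  define \<Phi> where "\<Phi> z = (\<Sum>b\<in>B. norm (F' z (0, b) - b))" for z
  have "continuous_on S \<Phi>"
    unfolding \<Phi>_def using B(1) V
    by (intro continuous_intros F'_cont) (auto simp: subspace_0)
  moreover have "\<Phi> (p, p) = 0"
    unfolding \<Phi>_def using F'_p B(1) by (auto intro!: sum.neutral)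
  ultimately obtain r0 where r0: "r0 > 0" "\<And>z. z \<in> S \<Longrightarrow> dist z (p, p) < r0 \<Longrightarrow> \<bar>\<Phi> z\<bar> < \<epsilon>"
    using pS \<open>\<epsilon> > 0\<close> unfolding continuous_on_iff by (force simp: dist_real_def)
  have F'_near: "norm (F' z (0, v) - v) \<le> \<Phi> z * norm v" if z: "z \<in> S" and v: "v \<in> V" for z v
  proof -
    have lin: "linear (\<lambda>v. F' z (0, v) - v)"
    proof -
      have "linear (F' z)"
        using F'[OF z] has_derivative_linear by blast
      then have "linear (\<lambda>v. F' z (0, v))"
        using linear_compose[of "\<lambda>v. (0, v)" "F' z"]
        by (simp add: o_def linear_iff)
      then show ?thesis
        by (intro linear_compose_sub linear_ident)
    qed
    have "v = (\<Sum>b\<in>B. (v \<bullet> b) *\<^sub>R b)"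
      using orthonormal_basis_expand[of B v] B v \<open>finite B\<close> by simp
    then have "F' z (0, v) - v = (\<Sum>b\<in>B. (v \<bullet> b) *\<^sub>R (F' z (0, b) - b))"
      using linear_sum[OF lin, of "\<lambda>b. (v \<bullet> b) *\<^sub>R b" B] linear_cmul[OF lin]
      by (metis (no_types, lifting) sum.cong)
    then have "norm (F' z (0, v) - v) \<le> (\<Sum>b\<in>B. norm v * norm (F' z (0, b) - b))"
    proof (simp only:, intro sum_norm_le)
      fix b assume "b \<in> B"
      then have "\<bar>v \<bullet> b\<bar> \<le> norm v"
        using Cauchy_Schwarz_ineq2[of v b] B(3) by simp
      then show "norm ((v \<bullet> b) *\<^sub>R (F' z (0, b) - b)) \<le> norm v * norm (F' z (0, b) - b)"
        by (simp add: mult_right_mono)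
    qed
    then show ?thesis
      by (simp add: \<Phi>_def sum_distrib_left mult.commute)
  qed
  show thesis
  proof
    show "min \<rho> r0 / 2 > 0"
      using \<rho> r0 by simp
    fix x y assume xy: "x \<in> V" "y \<in> V" "dist x p < min \<rho> r0 / 2" "dist y p < min \<rho> r0 / 2"
    have near: "dist (x, p + t *\<^sub>R (y - p)) (p, p) < min \<rho> r0" if "t \<in> {0..1}" for t
    proof -
      have "dist (x, p + t *\<^sub>R (y - p)) (p, p) \<le> dist x p + dist (p + t *\<^sub>R (y - p)) p"
        by (simp add: dist_Pair_Pair sqrt_sum_squares_le_sum)
      moreover have "dist (p + t *\<^sub>R (y - p)) p \<le> dist y p"
        using that by (simp add: dist_norm mult_left_le_one_le)
      ultimately show ?thesis
        using xy by linarith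
    qed
    have inS: "(x, p + t *\<^sub>R (y - p)) \<in> S" if "t \<in> {0..1}" for t
      using \<rho>(2)[of "(x, p + t *\<^sub>R (y - p))"] near[OF that] xy pV V
      by (auto simp: subspace_add subspace_scale subspace_diff)
    have yp: "y - p \<in> V"
      using xy pV V by (simp add: subspace_diff)
    define \<gamma> where "\<gamma> t = F (x, p + t *\<^sub>R (y - p)) - t *\<^sub>R (y - p)" for t
    have "norm (\<gamma> 1 - \<gamma> 0) \<le> (\<epsilon> * norm (y - p)) * norm (1 - 0 :: real)"
    proof (rule differentiable_bound[where S = "{0..1}"])
      fix t :: real assume t: "t \<in> {0..1}"
      let ?z = "(x, p + t *\<^sub>R (y - p))"
      have "linear (F' ?z)"
        using F'[OF inS[OF t]] has_derivative_linear by blast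
      then have scale: "F' ?z (0, h *\<^sub>R (y - p)) = h *\<^sub>R F' ?z (0, y - p)" for h
        using linear_cmul[of "F' ?z" h "(0, y - p)"] by simp
      have "((\<lambda>t. F (x, p + t *\<^sub>R (y - p))) has_derivative (\<lambda>h. F' ?z (0, h *\<^sub>R (y - p)))) (at t within {0..1})"
      proof (rule has_derivative_in_compose2[where t = S and g = F and g' = F'])
        show "((\<lambda>t. (x, p + t *\<^sub>R (y - p))) has_derivative (\<lambda>h. (0, h *\<^sub>R (y - p)))) (at t within {0..1})"
          by (auto intro!: derivative_eq_intros)
      next
        show "(\<lambda>t. (x, p + t *\<^sub>R (y - p))) ` {0..1} \<subseteq> S"
          using inS by blast
      qed (use F' t in \<open>blast+\<close>)
      then have "(\<gamma> has_derivative (\<lambda>h. h *\<^sub>R F' ?z (0, y - p) - h *\<^sub>R (y - p))) (at t within {0..1})"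
        unfolding \<gamma>_def scale by (auto intro!: derivative_eq_intros)
      then show "(\<gamma> has_derivative (\<lambda>h. h *\<^sub>R (F' ?z (0, y - p) - (y - p)))) (at t within {0..1})"
        by (simp add: scaleR_right_diff_distrib)
      have "norm (F' ?z (0, y - p) - (y - p)) \<le> \<Phi> ?z * norm (y - p)"
        by (rule F'_near[OF inS[OF t] yp])
      also have "\<dots> \<le> \<epsilon> * norm (y - p)"
        using r0(2)[OF inS[OF t]] near[OF t] by (intro mult_right_mono) auto
      finally show "onorm (\<lambda>h. h *\<^sub>R (F' ?z (0, y - p) - (y - p))) \<le> \<epsilon> * norm (y - p)"
        by (intro onorm_le) (simp add: mult.commute mult_left_mono)
    qed auto
    moreover have "\<gamma> 1 = F (x, y) - (y - p)" "\<gamma> 0 = x"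
      using unit inS[of 0] by (auto simp: \<gamma>_def)
    ultimately show "(x, y) \<in> S \<and> norm (F (x, y) - x - (y - p)) \<le> \<epsilon> * norm (y - p)"
      using inS[of 1] by (simp add: algebra_simps)
  qed
qed

definition coordinate_ball :: "'g set \<Rightarrow> ('g \<Rightarrow> 'e::real_normed_vector) \<Rightarrow> real \<Rightarrow> 'g set" where
  "coordinate_ball U f r = {g \<in> U. norm (f g) < r}"

context lie_group
begin

lemma carrier_in_topspace [simp]: "g \<in> carrier G \<Longrightarrow> g \<in> topspace X"
  by (simp add: topspace_carrier)

lemma group_Hausdorff: "Hausdorff_space X"
  by (rule Hausdorff)

lemma continuous_mult: "continuous_map (prod_topology X X) X (\<lambda>(g, h). g \<otimes> h)"
  using smooth_mult unfolding smooth_map_def by blast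

lemma continuous_inverse: "continuous_map X X (\<lambda>g. inv g)"
  using smooth_inverse unfolding smooth_map_def by blast

lemma continuous_map_mult [continuous_intros]:
  assumes "continuous_map Y X f" "continuous_map Y X f'"
  shows "continuous_map Y X (\<lambda>y. f y \<otimes> f' y)"
  using continuous_map_compose[OF continuous_map_pairedI[OF assms] continuous_mult]
  by (simp add: o_def)

lemma continuous_map_inverse [continuous_intros]:
  assumes "continuous_map Y X f"
  shows "continuous_map Y X (\<lambda>y. inv (f y))"
  using continuous_map_compose[OF assms continuous_inverse] by (simp add: o_def)

text \<open>
  A chart centred at the unit whose balls form a neighbourhood base there, and in which right
  multiplication by a small element b is translation by f b up to an error that is small relative
  to the norm of f b. All later arguments about the Lie group use its smooth structure only
  through such a chart.
\<close>

definition linearizing_chart :: "'g set \<Rightarrow> ('g \<Rightarrow> 'e) \<Rightarrow> bool" where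
  "linearizing_chart U f \<longleftrightarrow>
     U \<subseteq> carrier G \<and> \<one> \<in> U \<and> f \<one> = 0 \<and> (\<forall>g\<in>U. f g = 0 \<longrightarrow> g = \<one>) \<and>
     (\<forall>r. openin X (coordinate_ball U f r)) \<and>
     (\<forall>W. openin X W \<longrightarrow> \<one> \<in> W \<longrightarrow> (\<exists>r>0. coordinate_ball U f r \<subseteq> W)) \<and>
     (\<forall>\<epsilon>>0. \<exists>r>0. \<forall>a\<in>coordinate_ball U f r. \<forall>b\<in>coordinate_ball U f r.
        a \<otimes> b \<in> U \<and> norm (f (a \<otimes> b) - f a - f b) \<le> \<epsilon> * norm (f b))"

lemma linearizing_chart_exists: "\<exists>U f. linearizing_chart U f"
proof -
  obtain U c where Uc: "(U, c) \<in> \<A>" and oneU: "\<one> \<in> U"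
    using charts_cover topspace_carrier one_closed by blast
  define f where "f g = c g - c \<one>" for g
  have UX: "U \<subseteq> topspace X" and UG: "U \<subseteq> carrier G" and openU: "openin X U"
    using chart_domain[OF Uc] openin_subset topspace_carrier by auto
  have hom: "homeomorphic_map (subtopology X U) (top_of_set (c ` U)) c"
    by (rule chart_homeomorphic[OF Uc])
  have topU: "topspace (subtopology X U) = U"
    using UX by auto
  have inj: "inj_on c U"
    using homeomorphic_imp_injective_map[OF hom] topU by simp
  have cV: "c ` U \<subseteq> V"
    using chart_image[OF Uc] openin_imp_subset by blast
  have near_open: "openin X (coordinate_ball U f r)" for r
  proof -
    have "openin (subtopology X U) {g \<in> topspace (subtopology X U). c g \<in> c ` U \<inter> ball (c \<one>) r}"
      by (rule openin_continuous_map_preimage[OF homeomorphic_imp_continuous_map[OF hom]])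
        (simp add: openin_open_Int)
    also have "{g \<in> topspace (subtopology X U). c g \<in> c ` U \<inter> ball (c \<one>) r} = coordinate_ball U f r"
      unfolding topU by (auto simp: coordinate_ball_def f_def dist_norm norm_minus_commute)
    finally show ?thesis
      using openU openin_open_subtopology by blast
  qed
  have near_small: "\<exists>r>0. coordinate_ball U f r \<subseteq> W" if W: "openin X W" "\<one> \<in> W" for W
  proof -
    have "openin (subtopology X U) (U \<inter> W)"
      using W(1) by (simp add: openin_subtopology_Int2)
    then have "openin (top_of_set (c ` U)) (c ` (U \<inter> W))"
      using homeomorphic_map_openness[OF hom, of "U \<inter> W"] topU by auto
    then have "openin (top_of_set V) (c ` (U \<inter> W))"
      using chart_image[OF Uc] openin_trans by blast
    then obtain r where r: "r > 0" "\<And>v. v \<in> V \<Longrightarrow> dist v (c \<one>) < r \<Longrightarrow> v \<in> c ` (U \<inter> W)"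
      using oneU W(2) unfolding openin_euclidean_subtopology_iff by (metis IntI imageI)
    have "g \<in> W" if "g \<in> coordinate_ball U f r" for g
    proof -
      have "c g \<in> c ` (U \<inter> W)" "g \<in> U"
        using that r(2)[of "c g"] cV by (auto simp: coordinate_ball_def f_def dist_norm)
      then show ?thesis
        using inj by (metis IntD1 IntD2 imageE inj_onD)
    qed
    with r(1) show ?thesis by blast
  qed
  have estimate: "\<exists>r>0. \<forall>a\<in>coordinate_ball U f r. \<forall>b\<in>coordinate_ball U f r.
        a \<otimes> b \<in> U \<and> norm (f (a \<otimes> b) - f a - f b) \<le> \<epsilon> * norm (f b)" if "\<epsilon> > 0" for \<epsilon>
  proof -
    let ?m = "\<lambda>(g, h). g \<otimes> h"
    let ?D = "(U \<times> U) \<inter> ?m -` U"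
    let ?S = "map_prod c c ` ?D"
    define F where "F = c \<circ> ?m \<circ> inv_into (U \<times> U) (map_prod c c)"
    have injUU: "inj_on (map_prod c c) (U \<times> U)"
      using inj by (rule map_prod_inj_on) (rule inj)
    have F: "F (c a, c b) = c (a \<otimes> b)" if "a \<in> U" "b \<in> U" for a b
      using inv_into_f_f[OF injUU, of "(a, b)"] that by (simp add: F_def)
    have "(U \<times> U, map_prod c c) \<in> product_atlas \<A> \<A>"
      using Uc unfolding product_atlas_def by blast
    then have "smooth_on (V \<times> V) ?S F"
      using smooth_mult Uc unfolding smooth_map_def F_def by fast
    then have C1: "C_diff (V \<times> V) 1 ?S F"
      unfolding smooth_on_def by blast
    have openD: "openin (prod_topology X X) ?D"
    proof -
      have "openin (prod_topology X X) {z \<in> topspace (prod_topology X X). ?m z \<in> U}"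
        by (rule openin_continuous_map_preimage[OF continuous_mult openU])
      moreover have "openin (prod_topology X X) (U \<times> U)"
        using openU by (simp add: openin_prod_Times_iff)
      ultimately have "openin (prod_topology X X) ((U \<times> U) \<inter> {z \<in> topspace (prod_topology X X). ?m z \<in> U})"
        by (rule openin_Int[rotated])
      moreover have "(U \<times> U) \<inter> {z \<in> topspace (prod_topology X X). ?m z \<in> U} = ?D"
        using UX by auto
      ultimately show ?thesis by simp
    qed
    have Sopen: "openin (top_of_set (V \<times> V)) ?S"
    proof -
      have "homeomorphic_map (prod_topology (subtopology X U) (subtopology X U))
              (prod_topology (top_of_set (c ` U)) (top_of_set (c ` U))) (\<lambda>(x, y). (c x, c y))"
        using hom homeomorphic_maps_prod unfolding homeomorphic_map_maps by blast
      moreover have "(\<lambda>(x, y). (c x, c y)) = map_prod c c"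
        by auto
      ultimately have hom2: "homeomorphic_map (subtopology (prod_topology X X) (U \<times> U))
              (top_of_set (c ` U \<times> c ` U)) (map_prod c c)"
        by (simp add: subtopology_Times)
      have "openin (subtopology (prod_topology X X) (U \<times> U)) ?D"
        using openin_subtopology_Int2[OF openD, of "U \<times> U"] by (simp add: Int_absorb1)
      then have "openin (top_of_set (c ` U \<times> c ` U)) ?S"
        using homeomorphic_map_openness[OF hom2, of ?D] openin_subset by blast
      moreover have "openin (top_of_set (V \<times> V)) (c ` U \<times> c ` U)"
        using chart_image[OF Uc] by (simp add: openin_Times)
      ultimately show ?thesis
        using openin_trans by blast
    qed
    have memS: "a \<otimes> b \<in> U" if ab_in: "(c a, c b) \<in> ?S" "a \<in> U" "b \<in> U" for a b
    proof -
      obtain a' b' where ab: "a' \<in> U" "b' \<in> U" "a' \<otimes> b' \<in> U" "c a' = c a" "c b' = c b"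
        using ab_in(1) by auto
      then have "a' = a" "b' = b"
        using inj ab_in(2,3) by (auto dest: inj_onD)
      with ab show ?thesis by simp
    qed
    have pS: "(c \<one>, c \<one>) \<in> ?S"
      using oneU by (intro image_eqI[of _ _ "(\<one>, \<one>)"]) auto
    have unit1: "F (c \<one>, y) = y" if "(c \<one>, y) \<in> ?S" for y
      using that F[OF oneU] UG by (auto simp: subset_iff)
    have unit2: "F (x, c \<one>) = x" if "(x, c \<one>) \<in> ?S" for x
      using that F[OF _ oneU] UG by (auto simp: subset_iff)
    obtain r where r: "r > 0" "\<And>x y. \<lbrakk>x \<in> V; y \<in> V; dist x (c \<one>) < r; dist y (c \<one>) < r\<rbrakk>
       \<Longrightarrow> (x, y) \<in> ?S \<and> norm (F (x, y) - x - (y - c \<one>)) \<le> \<epsilon> * norm (y - c \<one>)"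
      using C1_translation_estimate[OF model_subspace Sopen pS C1 unit1 unit2 \<open>\<epsilon> > 0\<close>] by blast
    show ?thesis
    proof (intro exI conjI ballI)
      show "r > 0" by fact
      fix a b assume ab: "a \<in> coordinate_ball U f r" "b \<in> coordinate_ball U f r"
      then have abU: "a \<in> U" "b \<in> U"
        by (auto simp: coordinate_ball_def)
      then have "c a \<in> V" "c b \<in> V"
        using cV by auto
      with ab have rr: "(c a, c b) \<in> ?S"
         "norm (F (c a, c b) - c a - (c b - c \<one>)) \<le> \<epsilon> * norm (c b - c \<one>)"
        using r(2)[of "c a" "c b"] by (auto simp: coordinate_ball_def f_def dist_norm)
      show "a \<otimes> b \<in> U"
        using memS[OF rr(1) abU] .
      show "norm (f (a \<otimes> b) - f a - f b) \<le> \<epsilon> * norm (f b)"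
        using rr(2) F[OF abU] by (simp add: f_def algebra_simps)
    qed
  qed
  have "\<forall>g\<in>U. f g = 0 \<longrightarrow> g = \<one>"
    using inj oneU by (auto simp: f_def dest: inj_onD)
  moreover have "f \<one> = 0"
    by (simp add: f_def)
  ultimately have "linearizing_chart U f"
    unfolding linearizing_chart_def using UG oneU near_open near_small estimate by blast
  then show ?thesis by blast
qed

section \<open>Subgroups slightly larger than a closed subgroup\<close>

text \<open>
  Suppose there are subgroups K n containing L properly and contained in ever smaller
  neighbourhoods of L. Pick w n in K n - L, tending to the unit and of nearly minimal norm within
  its coset of L. Pass to a subsequence along which the directions of w n converge. For n large,
  a suitable power of w n has almost the same coordinates as a given earlier w m; this power lies
  in K n, so it is close to some l in L. Then inv l \<otimes> w m lies in the same coset as w m but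
  is much shorter, contrary to the choice of w m.
\<close>

lemma no_small_overgroups:
  assumes L: "subgroup L G" and closed: "closedin X L"
  shows "\<exists>N. openin X N \<and> L \<subseteq> N \<and> (\<forall>K. subgroup K G \<longrightarrow> L \<subseteq> K \<longrightarrow> K \<subseteq> N \<longrightarrow> K = L)"
proof (rule ccontr)
  assume contra: "\<not> ?thesis"
  note LG = subgroup.subset[OF L]
  obtain U and f :: "'g \<Rightarrow> 'e" where "linearizing_chart U f"
    using linearizing_chart_exists by blast
  then have U: "U \<subseteq> carrier G" "\<one> \<in> U" and f1: "f \<one> = 0"
    and f0: "\<And>g. g \<in> U \<Longrightarrow> f g = 0 \<Longrightarrow> g = \<one>"
    and near_open: "\<And>r. openin X (coordinate_ball U f r)"
    and near_small: "\<And>W. openin X W \<Longrightarrow> \<one> \<in> W \<Longrightarrow> \<exists>r>0. coordinate_ball U f r \<subseteq> W"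
    and estimate: "\<And>\<epsilon>. \<epsilon> > 0 \<Longrightarrow> \<exists>r>0. \<forall>a\<in>coordinate_ball U f r. \<forall>b\<in>coordinate_ball U f r.
        a \<otimes> b \<in> U \<and> norm (f (a \<otimes> b) - f a - f b) \<le> \<epsilon> * norm (f b)"
    unfolding linearizing_chart_def by simp_all
  let ?B = "coordinate_ball U f"
  have one_near: "r > 0 \<Longrightarrow> \<one> \<in> ?B r" for r
    using U f1 by (simp add: coordinate_ball_def)
  have near_mono: "g \<in> ?B r \<Longrightarrow> r \<le> r' \<Longrightarrow> g \<in> ?B r'" for g r r'
    by (auto simp: coordinate_ball_def)
  have near_carrier: "g \<in> ?B r \<Longrightarrow> g \<in> carrier G" for g r
    using U by (auto simp: coordinate_ball_def)
  \<comment> \<open>The final contradiction needs 12 \<epsilon> / (1 - \<epsilon>) < 1.\<close>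
  define \<epsilon> :: real where "\<epsilon> = 1 / 16"
  obtain r where r: "r > 0" and est: "\<And>a b. a \<in> ?B r \<Longrightarrow> b \<in> ?B r \<Longrightarrow>
        a \<otimes> b \<in> U \<and> norm (f (a \<otimes> b) - f a - f b) \<le> \<epsilon> * norm (f b)"
    using estimate[of \<epsilon>] by (auto simp: \<epsilon>_def)
  have close_under: "\<exists>r'>0. r' \<le> r \<and> (\<forall>a\<in>?B r'. \<forall>b\<in>?B r'. k a b \<in> ?B r)"
    if k: "continuous_map (prod_topology X X) X (\<lambda>(a, b). k a b)" "k \<one> \<one> = \<one>" for k
  proof -
    have "openin (prod_topology X X) {z \<in> topspace (prod_topology X X). (\<lambda>(a, b). k a b) z \<in> ?B r}"
      by (rule openin_continuous_map_preimage[OF k(1) near_open])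
    moreover have "(\<one>, \<one>) \<in> {z \<in> topspace (prod_topology X X). (\<lambda>(a, b). k a b) z \<in> ?B r}"
      using one_near[OF r] k(2) by simp
    ultimately obtain W W' where W: "openin X W" "openin X W'" "\<one> \<in> W" "\<one> \<in> W'"
        "W \<times> W' \<subseteq> {z \<in> topspace (prod_topology X X). (\<lambda>(a, b). k a b) z \<in> ?B r}"
      unfolding openin_prod_topology_alt by (smt (verit))
    then obtain r' where r': "r' > 0" "?B r' \<subseteq> W \<inter> W'"
      using near_small[of "W \<inter> W'"] by auto
    have "?B (min r' r) \<subseteq> ?B r'"
      using near_mono by auto
    then have "(a, b) \<in> W \<times> W'" if "a \<in> ?B (min r' r)" "b \<in> ?B (min r' r)" for a b
      using r'(2) that by blast
    then have "k a b \<in> ?B r" if "a \<in> ?B (min r' r)" "b \<in> ?B (min r' r)" for a b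
      using subsetD[OF W(5)] that by fastforce
    moreover have "min r' r > 0" "min r' r \<le> r"
      using r r'(1) by auto
    ultimately show ?thesis
      by blast
  qed
  have "continuous_map (prod_topology X X) X (\<lambda>(a, b). a \<otimes> inv b)"
    "continuous_map (prod_topology X X) X (\<lambda>(a, b). inv a \<otimes> b)"
    unfolding case_prod_unfold
    by (intro continuous_intros continuous_map_fst continuous_map_snd)+
  then obtain r1 r2 where r12: "r1 > 0" "r1 \<le> r" "\<And>a b. a \<in> ?B r1 \<Longrightarrow> b \<in> ?B r1 \<Longrightarrow> a \<otimes> inv b \<in> ?B r"
     "r2 > 0" "r2 \<le> r" "\<And>a b. a \<in> ?B r2 \<Longrightarrow> b \<in> ?B r2 \<Longrightarrow> inv a \<otimes> b \<in> ?B r"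
    using close_under[of "\<lambda>a b. a \<otimes> inv b"] close_under[of "\<lambda>a b. inv a \<otimes> b"] by auto
  define r' where "r' = min r1 r2"
  have r': "r' > 0" "r' \<le> r" "\<And>a b. a \<in> ?B r' \<Longrightarrow> b \<in> ?B r' \<Longrightarrow> a \<otimes> inv b \<in> ?B r"
      "\<And>a b. a \<in> ?B r' \<Longrightarrow> b \<in> ?B r' \<Longrightarrow> inv a \<otimes> b \<in> ?B r"
    using r12 near_mono[of _ r' r1] near_mono[of _ r' r2] by (auto simp: r'_def)

  \<comment> \<open>Errors of successive multiplications by v add up, so v [^] k has coordinates near k \<cdot> f v.\<close>
  have pow: "v [^] k \<in> ?B r \<and> norm (f (v [^] k) - real k *\<^sub>R f v) \<le> \<epsilon> * (real k * norm (f v))"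
    if v: "v \<in> ?B r" and kr: "(1 + \<epsilon>) * (real k * norm (f v)) < r" for v and k :: nat
    using kr
  proof (induction k)
    case 0
    show ?case using one_near[OF r] f1 by simp
  next
    case (Suc k)
    have "(1 + \<epsilon>) * (real k * norm (f v)) \<le> (1 + \<epsilon>) * (real (Suc k) * norm (f v))"
      by (intro mult_left_mono mult_right_mono) (auto simp: \<epsilon>_def)
    with Suc have IH: "v [^] k \<in> ?B r" "norm (f (v [^] k) - real k *\<^sub>R f v) \<le> \<epsilon> * (real k * norm (f v))"
      by auto
    note e = est[OF IH(1) v]
    have "f (v [^] Suc k) - real (Suc k) *\<^sub>R f v
        = (f (v [^] k \<otimes> v) - f (v [^] k) - f v) + (f (v [^] k) - real k *\<^sub>R f v)"
      by (simp add: algebra_simps)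
    then have "norm (f (v [^] Suc k) - real (Suc k) *\<^sub>R f v)
        \<le> \<epsilon> * norm (f v) + \<epsilon> * (real k * norm (f v))"
      using e IH(2) by (metis (no_types, lifting) add_mono norm_triangle_le)
    then have *: "norm (f (v [^] Suc k) - real (Suc k) *\<^sub>R f v) \<le> \<epsilon> * (real (Suc k) * norm (f v))"
      by (simp add: algebra_simps)
    have "norm (f (v [^] Suc k)) \<le> norm (f (v [^] Suc k) - real (Suc k) *\<^sub>R f v) + norm (real (Suc k) *\<^sub>R f v)"
      by (metis diff_add_cancel norm_triangle_ineq)
    also have "norm (real (Suc k) *\<^sub>R f v) = real (Suc k) * norm (f v)"
      by (simp only: norm_scaleR abs_of_nat)
    also have "norm (f (v [^] Suc k) - real (Suc k) *\<^sub>R f v) + real (Suc k) * norm (f v)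
        \<le> (1 + \<epsilon>) * (real (Suc k) * norm (f v))"
      using * by (simp only: distrib_right mult_1_left add.commute add_le_cancel_left)
    also note Suc.prems
    finally show ?case
      using * e by (simp add: coordinate_ball_def)
  qed

  \<comment> \<open>The infimum of the norms over the coset is positive as L is closed; w comes within a factor 2.\<close>
  have witness: "\<exists>K w. subgroup K G \<and> L \<subseteq> K \<and> (\<forall>x\<in>K. \<exists>l\<in>L. inv l \<otimes> x \<in> ?B \<rho>) \<and>
      w \<in> K \<and> w \<notin> L \<and> w \<in> ?B \<rho> \<and>
      (\<forall>l\<in>L. inv l \<otimes> w \<in> U \<longrightarrow> norm (f w) < 2 * norm (f (inv l \<otimes> w)))"
    if "\<rho> > 0" for \<rho>
  proof -
    define N where "N = (\<Union>l\<in>L. {x \<in> topspace X. inv l \<otimes> x \<in> ?B \<rho>})"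
    have "openin X {x \<in> topspace X. inv l \<otimes> x \<in> ?B \<rho>}" if "l \<in> L" for l
      using that LG near_open
      by (intro openin_continuous_map_preimage[where Y = X] continuous_intros) auto
    then have "openin X N"
      unfolding N_def by blast
    moreover have "L \<subseteq> N"
    proof
      fix l assume "l \<in> L"
      then show "l \<in> N"
        using LG one_near[OF that] unfolding N_def by (intro UN_I[of l]) (auto simp: subset_iff)
    qed
    ultimately obtain K where K: "subgroup K G" "L \<subseteq> K" "K \<subseteq> N" "K \<noteq> L"
      using contra by blast
    then obtain x where x: "x \<in> K" "x \<notin> L"
      by blast
    then obtain l0 where l0: "l0 \<in> L" "inv l0 \<otimes> x \<in> ?B \<rho>"
      using K(3) by (auto simp: N_def)
    define b where "b = inv l0 \<otimes> x"
    have coset: "inv l \<otimes> b \<in> K \<and> inv l \<otimes> b \<notin> L" if "l \<in> L" for l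
    proof -
      have c: "l \<in> carrier G" "l0 \<in> carrier G" "x \<in> carrier G"
        using that l0 LG x K(1) subgroup.subset by blast+
      have "inv l \<otimes> b \<in> K"
        using that l0 K(1,2) x unfolding b_def
        by (meson subgroup.m_closed subgroup.m_inv_closed subset_iff)
      moreover have "x = l0 \<otimes> (l \<otimes> (inv l \<otimes> b))"
        using c by (simp add: b_def m_assoc[symmetric] r_inv)
      then have "inv l \<otimes> b \<notin> L"
        using that l0 L x(2) by (metis subgroup.m_closed)
      ultimately show ?thesis by blast
    qed
    have bG: "b \<in> carrier G"
      using near_carrier l0(2) by (simp add: b_def)
    define D where "D = {norm (f (inv l \<otimes> b)) | l. l \<in> L \<and> inv l \<otimes> b \<in> U}"
    have "\<one> \<in> L"
      using L subgroup.one_closed by blast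
    then have bD: "norm (f b) \<in> D"
      using l0(2) bG unfolding D_def b_def[symmetric] by (force simp: coordinate_ball_def)
    have bdd: "bdd_below D"
      unfolding D_def by (intro bdd_belowI[of _ 0]) auto
    have "\<exists>d>0. \<forall>y\<in>D. d \<le> y"
    proof -
      have clo: "closedin X {y \<in> topspace X. b \<otimes> inv y \<in> L}"
        using bG closed
        by (intro closedin_continuous_map_preimage[where Y = X] continuous_intros) auto
      define W where "W = topspace X - {y \<in> topspace X. b \<otimes> inv y \<in> L}"
      have "openin X W"
        using clo unfolding W_def by blast
      moreover have "\<one> \<in> W"
        using coset[OF \<open>\<one> \<in> L\<close>] bG by (simp add: W_def)
      ultimately obtain d where d: "d > 0" "?B d \<subseteq> W"
        using near_small by blast
      have "d \<le> norm (f (inv l \<otimes> b))" if "l \<in> L" "inv l \<otimes> b \<in> U" for l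
      proof (rule ccontr)
        assume "\<not> ?thesis"
        then have "inv l \<otimes> b \<in> W"
          using that d(2) by (auto simp: coordinate_ball_def)
        moreover have "b \<otimes> inv (inv l \<otimes> b) = l"
          using that LG bG by (auto simp: inv_mult_group m_assoc[symmetric] r_inv)
        ultimately show False
          using that by (simp add: W_def)
      qed
      with d(1) show ?thesis
        by (auto simp: D_def)
    qed
    then obtain d where d: "d > 0" "\<And>y. y \<in> D \<Longrightarrow> d \<le> y"
      by blast
    have Inf: "0 < Inf D" "\<And>y. y \<in> D \<Longrightarrow> Inf D \<le> y"
      using d bD cInf_greatest[of D d] cInf_lower[OF _ bdd] by force+
    have "Inf D < min (2 * Inf D) \<rho>"
      using Inf(1) Inf(2)[OF bD] l0(2) by (simp add: coordinate_ball_def b_def)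
    then obtain y where y: "y \<in> D" "y < min (2 * Inf D) \<rho>"
      using cInf_less_iff[of D] bD bdd by blast
    then obtain l1 where l1: "l1 \<in> L" "inv l1 \<otimes> b \<in> U" "norm (f (inv l1 \<otimes> b)) < min (2 * Inf D) \<rho>"
      by (auto simp: D_def)
    define w where "w = inv l1 \<otimes> b"
    have "norm (f w) < 2 * norm (f (inv l \<otimes> w))" if l: "l \<in> L" "inv l \<otimes> w \<in> U" for l
    proof -
      have "inv l \<otimes> w = inv (l1 \<otimes> l) \<otimes> b"
        using l l1 LG bG unfolding w_def by (simp add: inv_mult_group m_assoc subset_iff)
      moreover have "l1 \<otimes> l \<in> L"
        using l l1 L by (simp add: subgroup.m_closed)
      ultimately have "norm (f (inv l \<otimes> w)) \<in> D"
        using l(2) by (auto simp: D_def)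
      from Inf(2)[OF this] show ?thesis
        using l1(3) by (simp add: w_def)
    qed
    moreover have "w \<in> K" "w \<notin> L" "w \<in> ?B \<rho>"
      using coset[OF l1(1)] l1 by (auto simp: w_def coordinate_ball_def)
    moreover have "\<forall>x\<in>K. \<exists>l\<in>L. inv l \<otimes> x \<in> ?B \<rho>"
      using K(3) by (auto simp: N_def)
    ultimately show ?thesis
      using K by blast
  qed

  \<comment> \<open>The bound r' / 2 leaves room for elements up to twice as long as w m.\<close>
  define \<rho> where "\<rho> n = r' / (2 * (real n + 1))" for n
  have \<rho>: "\<rho> n > 0" for n
    using r' by (simp add: \<rho>_def add_nonneg_pos)
  have \<rho>_half: "\<rho> n \<le> r' / 2" for n
    using r' by (simp add: \<rho>_def field_simps)
  have \<rho>_lim: "\<rho> \<longlonglongrightarrow> 0"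
    unfolding \<rho>_def by real_asymp
  have "\<forall>n. \<exists>K w. subgroup K G \<and> L \<subseteq> K \<and> (\<forall>x\<in>K. \<exists>l\<in>L. inv l \<otimes> x \<in> ?B (\<rho> n)) \<and>
      w \<in> K \<and> w \<notin> L \<and> w \<in> ?B (\<rho> n) \<and>
      (\<forall>l\<in>L. inv l \<otimes> w \<in> U \<longrightarrow> norm (f w) < 2 * norm (f (inv l \<otimes> w)))"
    using witness \<rho> by blast
  then obtain K w where
    K: "\<And>n. subgroup (K n) G" "\<And>n x. x \<in> K n \<Longrightarrow> \<exists>l\<in>L. inv l \<otimes> x \<in> ?B (\<rho> n)"
    and w: "\<And>n. w n \<in> K n" "\<And>n. w n \<notin> L" "\<And>n. w n \<in> ?B (\<rho> n)"
    and short: "\<And>n l. l \<in> L \<Longrightarrow> inv l \<otimes> w n \<in> U \<Longrightarrow> norm (f (w n)) < 2 * norm (f (inv l \<otimes> w n))"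
    by metis
  have wU: "w n \<in> U" "norm (f (w n)) < \<rho> n" for n
    using w(3)[of n] by (auto simp: coordinate_ball_def)
  have fw: "norm (f (w n)) > 0" for n
  proof -
    have "w n \<noteq> \<one>"
      using w(2)[of n] L subgroup.one_closed by metis
    then show ?thesis
      using f0[OF wU(1)[of n]] by auto
  qed
  define u where "u n = f (w n) /\<^sub>R norm (f (w n))" for n
  have nu: "norm (u n) = 1" for n
    using fw[of n] by (simp add: u_def)
  have fwu: "f (w n) = norm (f (w n)) *\<^sub>R u n" for n
    using fw[of n] by (simp add: u_def)
  have "\<forall>n. u n \<in> sphere 0 1"
    using nu by simp
  then obtain u0 \<sigma> where \<sigma>: "strict_mono (\<sigma> :: nat \<Rightarrow> nat)" "(u \<circ> \<sigma>) \<longlonglongrightarrow> u0"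
    using compact_sphere[of 0 1] unfolding compact_def by metis
  then obtain M where M: "\<And>i. i \<ge> M \<Longrightarrow> dist (u (\<sigma> i)) u0 < \<epsilon>"
    using \<sigma>(2) unfolding lim_sequentially \<epsilon>_def by (metis comp_apply zero_less_divide_1_iff zero_less_numeral)
  define m where "m = \<sigma> M"
  define s where "s = norm (f (w m))"
  have s: "s > 0" "s < r' / 2"
    using fw[of m] wU(2)[of m] \<rho>_half[of m] by (auto simp: s_def)
  have "eventually (\<lambda>i. \<rho> (\<sigma> i) < \<epsilon> * s) sequentially"
    using s(1) LIMSEQ_subseq_LIMSEQ[OF \<rho>_lim \<sigma>(1)]
    by (intro order_tendstoD(2)[of _ 0]) (auto simp: o_def \<epsilon>_def)
  moreover have "eventually (\<lambda>i. i \<ge> M) sequentially"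
    by (rule eventually_ge_at_top)
  ultimately obtain i where i: "\<rho> (\<sigma> i) < \<epsilon> * s" "i \<ge> M"
    using eventually_happens'[OF sequentially_bot eventually_conj] by blast
  define n where "n = \<sigma> i"
  define v where "v = w n"
  \<comment> \<open>Chosen so that k \<cdot> norm (f v) approximates s from below, up to norm (f v).\<close>
  define k where "k = nat \<lfloor>s / norm (f v)\<rfloor>"
  have nv: "norm (f v) > 0" "norm (f v) < \<epsilon> * s"
    using fw[of n] wU(2)[of n] i by (auto simp: v_def n_def)
  have k: "real k * norm (f v) \<le> s" "s - real k * norm (f v) \<le> \<epsilon> * s"
  proof -
    have k0: "real k = of_int \<lfloor>s / norm (f v)\<rfloor>"
      using s nv by (simp add: k_def)
    then have "real k \<le> s / norm (f v)" "s / norm (f v) < real k + 1"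
      by linarith+
    then have "real k * norm (f v) \<le> s" "s < (real k + 1) * norm (f v)"
      using nv(1) by (simp_all add: pos_le_divide_eq pos_divide_less_eq)
    then show "real k * norm (f v) \<le> s" "s - real k * norm (f v) \<le> \<epsilon> * s"
      using nv(2) by (auto simp: algebra_simps)
  qed
  have vr: "v \<in> ?B r"
    using w(3)[of n] near_mono \<rho>_half[of n] r' by (force simp: v_def)
  have "(1 + \<epsilon>) * (real k * norm (f v)) < r"
    using k(1) s r' by (simp add: \<epsilon>_def)
  from pow[OF vr this] have vk: "v [^] k \<in> ?B r" "norm (f (v [^] k) - real k *\<^sub>R f v) \<le> \<epsilon> * s"
    using k(1) by (auto simp: \<epsilon>_def)
  have "norm (f (v [^] k)) \<le> norm (f (v [^] k) - real k *\<^sub>R f v) + norm (real k *\<^sub>R f v)"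
    by (metis diff_add_cancel norm_triangle_ineq)
  also have "\<dots> \<le> \<epsilon> * s + s"
    using vk(2) k(1) by simp
  also have "\<dots> < r'"
    using s by (simp add: \<epsilon>_def)
  finally have vk': "v [^] k \<in> ?B r'"
    using vk(1) by (simp add: coordinate_ball_def)
  have "v [^] k \<in> K n"
    unfolding v_def
    by (induction k) (use w(1) K(1) in \<open>auto intro: subgroup.one_closed subgroup.m_closed\<close>)
  then obtain l where l: "l \<in> L" "inv l \<otimes> v [^] k \<in> ?B (\<rho> n)"
    using K(2) by blast
  define b where "b = inv l \<otimes> v [^] k"
  have lG: "l \<in> carrier G" and vG: "v \<in> carrier G" and bG: "b \<in> carrier G"
    using l LG vr near_carrier by (auto simp: b_def)
  have bn: "b \<in> ?B r'" "norm (f b) < \<epsilon> * s"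
    using l(2) near_mono[of b "\<rho> n" r'] \<rho>_half[of n] r' i by (auto simp: b_def coordinate_ball_def n_def)
  have leq: "l = v [^] k \<otimes> inv b"
    using lG vG by (simp add: b_def inv_mult_group m_assoc[symmetric] r_inv)
  have lr: "l \<in> ?B r"
    unfolding leq by (rule r'(3)[OF vk' bn(1)])
  have "l \<otimes> b = v [^] k"
    using lG vG by (simp add: b_def m_assoc[symmetric] r_inv)
  moreover have "b \<in> ?B r"
    using bn(1) r' near_mono by blast
  ultimately have "norm (f (v [^] k) - f l - f b) \<le> \<epsilon> * norm (f b)"
    using est[OF lr] by metis
  then have vkl: "norm (f (v [^] k) - f l) \<le> 2 * \<epsilon> * s"
    using bn(2) norm_triangle_ineq[of "f (v [^] k) - f l - f b" "f b"] s by (simp add: \<epsilon>_def)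
  have ku: "norm (real k *\<^sub>R f v - f (w m)) \<le> 3 * \<epsilon> * s"
  proof -
    have "real k *\<^sub>R f v - f (w m) = (real k * norm (f v) - s) *\<^sub>R u n + s *\<^sub>R (u n - u m)"
      using fwu[of n] fwu[of m] unfolding v_def s_def
      by (metis (no_types, lifting) add_diff_eq diff_add_cancel scaleR_diff_left scaleR_diff_right scaleR_scaleR)
    then have "norm (real k *\<^sub>R f v - f (w m)) \<le> \<bar>real k * norm (f v) - s\<bar> + s * norm (u n - u m)"
      using nu[of n] s by (metis (no_types, lifting) abs_of_pos mult.right_neutral norm_scaleR norm_triangle_ineq)
    moreover have "norm (u n - u m) \<le> 2 * \<epsilon>"
      using M[OF i(2)] M[of M] dist_triangle2[of "u n" "u m" u0] by (simp add: n_def m_def dist_norm)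
    then have "s * norm (u n - u m) \<le> s * (2 * \<epsilon>)"
      using s by (intro mult_left_mono) auto
    ultimately show ?thesis
      using k by (simp add: algebra_simps)
  qed
  have lw: "norm (f l - f (w m)) \<le> 6 * \<epsilon> * s"
    using vkl vk(2) ku norm_triangle_ineq[of "f l - f (v [^] k)" "f (v [^] k) - real k *\<^sub>R f v"]
      norm_triangle_ineq[of "f l - real k *\<^sub>R f v" "real k *\<^sub>R f v - f (w m)"]
    by (simp add: norm_minus_commute)
  have "norm (f l) \<le> norm (f l - f (w m)) + s"
    unfolding s_def by (metis diff_add_cancel norm_triangle_ineq)
  then have "norm (f l) < r'"
    using lw s by (simp add: \<epsilon>_def)
  then have lr': "l \<in> ?B r'"
    using lr by (simp add: coordinate_ball_def)
  have wr': "w m \<in> ?B r'"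
    using w(3)[of m] near_mono \<rho>_half[of m] r' by force
  define x where "x = inv l \<otimes> w m"
  have xr: "x \<in> ?B r"
    unfolding x_def by (rule r'(4)[OF lr' wr'])
  have "l \<otimes> x = w m"
    using lG near_carrier[OF wr'] by (simp add: x_def m_assoc[symmetric] r_inv)
  then have "norm (f (w m) - f l - f x) \<le> \<epsilon> * norm (f x)"
    using est[OF lr xr] by simp
  then have "norm (f x) \<le> 6 * \<epsilon> * s + \<epsilon> * norm (f x)"
    using lw norm_triangle_ineq[of "f (w m) - f l" "- (f (w m) - f l - f x)"]
    by (simp add: norm_minus_commute)
  moreover have "s < 2 * norm (f x)"
    using short[OF l(1)] xr unfolding x_def s_def coordinate_ball_def by blast
  ultimately show False
    using s by (simp add: \<epsilon>_def)
qed

text \<open>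
  The preimages H' n of H under conjugation by g [^] n decrease. Their intersection L is closed,
  and by compactness some H' n lies in the neighbourhood of L on which L is the only subgroup
  containing L. So the chain is constant from n on, and conjugating H' n = H' (Suc n) back gives
  the claim. In a general topological group this fails: conjugation can act on a compact
  subgroup like the right shift on one-sided sequences, whose image is a proper subgroup.
\<close>

lemma compact_subgroup_conjugate_eq:
  assumes H: "subgroup H G" and compact: "compactin X H" and g: "g \<in> carrier G"
    and sub: "\<And>h. h \<in> H \<Longrightarrow> inv g \<otimes> h \<otimes> g \<in> H" and h: "h \<in> H"
  shows "g \<otimes> h \<otimes> inv g \<in> H"
proof -
  note HG = subgroup.subset[OF H]
  have closed: "closedin X H"
    using compact Hausdorff compactin_imp_closedin by blast
  define c where "c n x = g [^] n \<otimes> x \<otimes> inv (g [^] n)" for n :: nat and x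
  have cG: "c n x \<in> carrier G" if "x \<in> carrier G" for n x
    using that g by (simp add: c_def)
  have c0: "c 0 x = x" if "x \<in> carrier G" for x
    using that by (simp add: c_def)
  have cSuc: "c (Suc n) x = g \<otimes> c n x \<otimes> inv g" if "x \<in> carrier G" for n x
    unfolding c_def nat_pow_Suc2[OF g] using that g by (simp add: inv_mult_group m_assoc)
  have c_mult: "c n (x \<otimes> y) = c n x \<otimes> c n y" if "x \<in> carrier G" "y \<in> carrier G" for n x y
  proof -
    have "inv (g [^] n) \<otimes> (g [^] n \<otimes> z) = z" if "z \<in> carrier G" for z
      using that g by (simp add: m_assoc[symmetric])
    then show ?thesis
      using that g by (simp add: c_def m_assoc)
  qed
  have c_hom: "c n \<in> hom G G" for n
    using cG c_mult by (intro homI)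
  define H' where "H' n = {x \<in> carrier G. c n x \<in> H}" for n
  have H'_sub: "subgroup (H' n) G" for n
  proof -
    interpret group_hom G G "c n"
      using c_hom is_group by (simp add: group_hom_def group_hom_axioms_def)
    have "\<one> \<in> H' n"
      using subgroup.one_closed[OF H] by (simp add: H'_def)
    then show ?thesis
      using H by (intro subgroupI) (auto simp: H'_def intro: subgroup.m_closed subgroup.m_inv_closed)
  qed
  have H'_closed: "closedin X (H' n)" for n
  proof -
    have "closedin X {x \<in> topspace X. c n x \<in> H}"
      unfolding c_def using g closed
      by (intro closedin_continuous_map_preimage[where Y = X] continuous_intros) auto
    then show ?thesis
      by (simp add: H'_def topspace_carrier)
  qed
  have H'_Suc: "H' (Suc n) \<subseteq> H' n" for n
  proof
    fix x assume x: "x \<in> H' (Suc n)"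
    then have xG: "x \<in> carrier G" and "g \<otimes> c n x \<otimes> inv g \<in> H"
      by (auto simp: H'_def cSuc)
    then have "inv g \<otimes> (g \<otimes> c n x \<otimes> inv g) \<otimes> g \<in> H"
      using sub by blast
    also have "inv g \<otimes> (g \<otimes> c n x \<otimes> inv g) \<otimes> g = c n x"
      using g cG[OF xG] by (simp add: m_assoc inv_solve_left')
    finally show "x \<in> H' n"
      using xG by (simp add: H'_def)
  qed
  have H'_mono: "H' n \<subseteq> H' m" if "m \<le> n" for m n
    using lift_Suc_antimono_le[of H', OF H'_Suc that] .
  have H'0: "H' 0 = H"
    using HG c0 by (auto simp: H'_def)
  define L where "L = (\<Inter>n. H' n)"
  have "subgroup L G"
    unfolding L_def using H'_sub by (intro subgroups_Inter) auto
  moreover have "closedin X L"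
    unfolding L_def using H'_closed by (intro closedin_Inter) auto
  ultimately obtain N where N: "openin X N" "L \<subseteq> N"
    "\<And>K. subgroup K G \<Longrightarrow> L \<subseteq> K \<Longrightarrow> K \<subseteq> N \<Longrightarrow> K = L"
    using no_small_overgroups by blast
  have "\<exists>n. H' n \<subseteq> N"
  proof -
    define \<C> where "\<C> = insert N (range (\<lambda>n. topspace X - H' n))"
    have "openin X (topspace X - H' n)" for n
      using H'_closed by blast
    then have "\<forall>C\<in>\<C>. openin X C"
      using N(1) by (auto simp: \<C>_def)
    moreover have "H \<subseteq> \<Union>\<C>"
    proof
      fix x assume "x \<in> H"
      then have "x \<in> topspace X"
        using HG by auto
      then show "x \<in> \<Union>\<C>"
        using N(2) by (cases "\<forall>n. x \<in> H' n") (auto simp: \<C>_def L_def)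
    qed
    ultimately obtain \<F> where \<F>: "finite \<F>" "\<F> \<subseteq> \<C>" "H \<subseteq> \<Union>\<F>"
      using compact unfolding compactin_def by meson
    then have "finite (\<F> - {N})" "\<F> - {N} \<subseteq> range (\<lambda>n. topspace X - H' n)"
      by (auto simp: \<C>_def)
    then obtain I where I: "finite I" "\<F> - {N} = (\<lambda>n. topspace X - H' n) ` I"
      using finite_subset_image by metis
    have "H' (Max (insert 0 I)) \<subseteq> N"
    proof
      fix x assume x: "x \<in> H' (Max (insert 0 I))"
      have xn: "x \<in> H' n" if "n \<in> insert 0 I" for n
        using H'_mono[of n "Max (insert 0 I)"] that I(1) x by (meson Max_ge finite_insert subsetD)
      then have "x \<in> H"
        using H'0 by auto
      then obtain C where C: "C \<in> \<F>" "x \<in> C"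
        using \<F>(3) by blast
      show "x \<in> N"
      proof (rule ccontr)
        assume "x \<notin> N"
        then have "C \<in> \<F> - {N}"
          using C by auto
        then obtain n where "n \<in> I" "C = topspace X - H' n"
          unfolding I(2) by blast
        with C(2) xn show False by auto
      qed
    qed
    then show ?thesis ..
  qed
  then obtain n where n: "H' n \<subseteq> N" ..
  have "H' n = L"
    using N(3)[OF H'_sub _ n] by (auto simp: L_def)
  then have stable: "H' n \<subseteq> H' (Suc n)"
    by (auto simp: L_def)
  define x where "x = inv (g [^] n) \<otimes> h \<otimes> g [^] n"
  have hG: "h \<in> carrier G"
    using h HG by blast
  then have xG: "x \<in> carrier G"
    using g by (simp add: x_def)
  have "c n x = h"
  proof -
    have "g [^] n \<otimes> (inv (g [^] n) \<otimes> h) = h"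
      using g hG by (simp add: m_assoc[symmetric])
    then show ?thesis
      using g hG by (simp add: c_def x_def m_assoc)
  qed
  then have "x \<in> H' (Suc n)"
    using stable h xG by (auto simp: H'_def)
  then show ?thesis
    using \<open>c n x = h\<close> by (simp add: H'_def cSuc xG)
qed

end

section \<open>Stabilizers of a proper action\<close>

context proper_G_manifold
begin

abbreviation "stab m \<equiv> stabilizer G \<phi> m"

lemma action_closed: "g \<in> carrier G \<Longrightarrow> m \<in> topspace XM \<Longrightarrow> \<phi> g m \<in> topspace XM"
  by (rule element_image[OF _ _ refl])

lemma continuous_action: "continuous_map (prod_topology XG XM) XM (\<lambda>(g, m). \<phi> g m)"
  using smooth_action unfolding smooth_map_def by blast

lemma continuous_translation:
  assumes "g \<in> carrier G"
  shows "continuous_map XM XM (\<phi> g)"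
proof -
  have "continuous_map XM (prod_topology XG XM) (\<lambda>m. (g, m))"
    using assms by (intro continuous_map_pairedI) (auto simp: topspace_carrier)
  from continuous_map_compose[OF this continuous_action] show ?thesis
    by (simp add: o_def)
qed

lemma compactin_stabilizer:
  assumes m: "m \<in> topspace XM"
  shows "compactin XG (stab m)"
proof -
  have "compactin (prod_topology XG XM)
      {z \<in> topspace (prod_topology XG XM). (case z of (g, m) \<Rightarrow> (\<phi> g m, m)) = (m, m)}"
    using proper_action m unfolding proper_map_def by simp
  then have "compactin XG (fst ` {z \<in> topspace (prod_topology XG XM). (case z of (g, m) \<Rightarrow> (\<phi> g m, m)) = (m, m)})"
    by (rule image_compactin) (rule continuous_map_fst)
  also have "fst ` {z \<in> topspace (prod_topology XG XM). (case z of (g, m) \<Rightarrow> (\<phi> g m, m)) = (m, m)} = stab m"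
    using m by (force simp: stabilizer_def topspace_carrier)
  finally show ?thesis .
qed

lemma closedin_stabilizer: "m \<in> topspace XM \<Longrightarrow> closedin XG (stab m)"
  by (intro compactin_imp_closedin group_Hausdorff compactin_stabilizer)

text \<open>
  Properness enters here: (g, x) \<mapsto> (\<phi> g x, x) is a closed map, and (m, m) is not in the
  closed image of the pairs (g, x) with g outside N.
\<close>

lemma stabilizers_nearby:
  assumes m: "m \<in> topspace XM" and N: "openin XG N" "stab m \<subseteq> N"
  shows "\<exists>W. openin XM W \<and> m \<in> W \<and> (\<forall>x\<in>W. stab x \<subseteq> N)"
proof -
  define F where "F = (\<lambda>(g, x). (\<phi> g x, x)) ` ((topspace XG - N) \<times> topspace XM)"
  have "closedin (prod_topology XG XM) ((topspace XG - N) \<times> topspace XM)"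
    using N(1) by (simp add: closedin_prod_Times_iff closedin_diff)
  then have "closedin (prod_topology XM XM) F"
    using proper_action unfolding F_def proper_map_def closed_map_def by blast
  then have "openin (prod_topology XM XM) (topspace (prod_topology XM XM) - F)"
    by blast
  moreover have "(m, m) \<in> topspace (prod_topology XM XM) - F"
    using m N(2) by (auto simp: F_def stabilizer_def topspace_carrier)
  ultimately obtain W W' where W: "openin XM W" "openin XM W'" "m \<in> W" "m \<in> W'"
      "W \<times> W' \<subseteq> topspace (prod_topology XM XM) - F"
    unfolding openin_prod_topology_alt by (smt (verit))
  show ?thesis
  proof (intro exI[of _ "W \<inter> W'"] conjI ballI)
    show "openin XM (W \<inter> W')" "m \<in> W \<inter> W'"
      using W by auto
    fix x assume x: "x \<in> W \<inter> W'"
    show "stab x \<subseteq> N"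
    proof
      fix g assume g: "g \<in> stab x"
      have "(x, x) \<in> W \<times> W'"
        using x by simp
      then have xx: "(x, x) \<notin> F" "x \<in> topspace XM"
        using W(5) by auto
      show "g \<in> N"
      proof (rule ccontr)
        assume "g \<notin> N"
        then have "(\<lambda>(g, x). (\<phi> g x, x)) (g, x) \<in> F"
          unfolding F_def using g xx(2) by (intro imageI) (auto simp: stabilizer_def topspace_carrier)
        then show False
          using xx(1) g by (simp add: stabilizer_def)
      qed
    qed
  qed
qed

text \<open>
  This replaces the slice theorem. Points near m have stabilizers close to that of m, and such a
  stabilizer cannot be a proper overgroup of it.
\<close>

lemma stabilizer_locally_maximal:
  assumes m: "m \<in> topspace XM"
  shows "\<exists>W. openin XM W \<and> m \<in> W \<and> (\<forall>x\<in>W. stab m \<subseteq> stab x \<longrightarrow> stab x = stab m)"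
proof -
  obtain N where N: "openin XG N" "stab m \<subseteq> N"
    "\<And>K. subgroup K G \<Longrightarrow> stab m \<subseteq> K \<Longrightarrow> K \<subseteq> N \<Longrightarrow> K = stab m"
    using no_small_overgroups[OF stabilizer_subgroup[OF m] closedin_stabilizer[OF m]] by blast
  obtain W where W: "openin XM W" "m \<in> W" "\<And>x. x \<in> W \<Longrightarrow> stab x \<subseteq> N"
    using stabilizers_nearby[OF m N(1,2)] by blast
  show ?thesis
  proof (intro exI[of _ W] conjI ballI impI)
    show "openin XM W" "m \<in> W"
      by fact+
    fix x assume x: "x \<in> W" "stab m \<subseteq> stab x"
    then have "x \<in> topspace XM"
      using W(1) openin_subset by blast
    then show "stab x = stab m"
      using N(3)[OF stabilizer_subgroup x(2) W(3)[OF x(1)]] by blast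
  qed
qed

lemma stabilizer_translate:
  assumes m: "m \<in> topspace XM" and g: "g \<in> carrier G"
  shows "h \<in> stab (\<phi> g m) \<longleftrightarrow> h \<in> carrier G \<and> inv g \<otimes> h \<otimes> g \<in> stab m"
proof (cases "h \<in> carrier G")
  case h: True
  have gm: "\<phi> g m \<in> topspace XM" and hgm: "\<phi> h (\<phi> g m) \<in> topspace XM"
    using m g h by (simp_all add: action_closed)
  have "\<phi> (inv g \<otimes> h \<otimes> g) m = \<phi> (inv g \<otimes> h) (\<phi> g m)"
    using m g h by (simp add: composition_rule)
  also have "\<dots> = \<phi> (inv g) (\<phi> h (\<phi> g m))"
    using gm g h by (simp add: composition_rule)
  finally have "\<phi> (inv g \<otimes> h \<otimes> g) m = \<phi> (inv g) (\<phi> h (\<phi> g m))" .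
  moreover have "\<phi> (inv g) (\<phi> h (\<phi> g m)) = m \<longleftrightarrow> \<phi> h (\<phi> g m) = \<phi> g m"
  proof
    assume "\<phi> (inv g) (\<phi> h (\<phi> g m)) = m"
    from orbit_sym_aux[OF _ hgm this] g show "\<phi> h (\<phi> g m) = \<phi> g m"
      by simp
  next
    assume "\<phi> h (\<phi> g m) = \<phi> g m"
    then show "\<phi> (inv g) (\<phi> h (\<phi> g m)) = m"
      using orbit_sym_aux[OF g m refl] by simp
  qed
  ultimately show ?thesis
    using g h by (simp add: stabilizer_def)
qed (simp add: stabilizer_def)

text \<open>
  The stabilizers of m and x are conjugate through y, so the inclusion says that conjugation maps
  the compact stabilizer of m into itself.
\<close>

lemma conjugate_stabilizers_eq:
  assumes m: "m \<in> topspace XM" and x: "x \<in> topspace XM"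
    and y: "y \<in> orbit G \<phi> m" and stab: "stab y = stab x" and sub: "stab m \<subseteq> stab x"
  shows "stab x = stab m"
proof -
  obtain g where g: "g \<in> carrier G" "y = \<phi> g m"
    using y by (auto simp: orbit_def)
  have conj: "h \<in> stab x \<longleftrightarrow> h \<in> carrier G \<and> inv g \<otimes> h \<otimes> g \<in> stab m" for h
    using stabilizer_translate[OF m g(1)] stab g(2) by blast
  have "h \<in> stab m" if "h \<in> stab x" for h
  proof -
    have h: "h \<in> carrier G" "inv g \<otimes> h \<otimes> g \<in> stab m"
      using that conj by auto
    have "g \<otimes> (inv g \<otimes> h \<otimes> g) \<otimes> inv g \<in> stab m"
    proof (rule compact_subgroup_conjugate_eq[OF stabilizer_subgroup[OF m] compactin_stabilizer[OF m] g(1) _ h(2)])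
      fix k assume "k \<in> stab m"
      then show "inv g \<otimes> k \<otimes> g \<in> stab m"
        using sub conj by blast
    qed
    moreover have "g \<otimes> (inv g \<otimes> h \<otimes> g) \<otimes> inv g = h"
    proof -
      have "g \<otimes> (inv g \<otimes> h) = h"
        using g(1) h(1) by (simp add: m_assoc[symmetric])
      then show ?thesis
        using g(1) h(1) by (simp add: m_assoc)
    qed
    ultimately show ?thesis by simp
  qed
  with sub show ?thesis by blast
qed

section \<open>Strata as a partition\<close>

abbreviation "strata \<equiv> orbit_type_strata G XG \<phi> XM"

abbreviation "isotropy H \<equiv> isotropy_set G \<phi> XM H"

lemma stratumE:
  assumes "S \<in> strata"
  obtains H C where "C \<in> connected_components_of (subtopology XM (isotropy H))"
    "S = saturation G \<phi> C" "C \<subseteq> topspace XM" "\<And>c. c \<in> C \<Longrightarrow> stab c = H" "C \<noteq> {}"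
proof -
  obtain H C where HC: "C \<in> connected_components_of (subtopology XM (isotropy H))"
    "S = saturation G \<phi> C"
    using assms unfolding orbit_type_strata_def by blast
  have "C \<subseteq> topspace XM \<inter> isotropy H"
    using connected_components_of_subset[OF HC(1)] by simp
  moreover have "C \<noteq> {}"
    using nonempty_connected_components_of[OF HC(1)] .
  ultimately show thesis
    using HC by (intro that[of C H]) (auto simp: isotropy_set_def)
qed

lemma saturation_iff: "x \<in> saturation G \<phi> C \<longleftrightarrow> (\<exists>c\<in>C. x \<in> orbit G \<phi> c)"
  by (auto simp: saturation_def)

lemma orbit_topspace: "m \<in> topspace XM \<Longrightarrow> x \<in> orbit G \<phi> m \<Longrightarrow> x \<in> topspace XM"
  by (auto simp: orbit_def action_closed)

lemma stratum_topspace: "S \<in> strata \<Longrightarrow> S \<subseteq> topspace XM"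
  by (erule stratumE) (metis orbit_topspace saturation_iff subsetD subsetI)

lemma stratum_nonempty: "S \<in> strata \<Longrightarrow> S \<noteq> {}"
  by (erule stratumE) (use orbit_refl in \<open>fastforce simp: saturation_iff\<close>)

lemma stratum_orbit:
  assumes S: "S \<in> strata" and x: "x \<in> S" and y: "y \<in> orbit G \<phi> x"
  shows "y \<in> S"
proof -
  obtain H C where C: "S = saturation G \<phi> C" "C \<subseteq> topspace XM"
    using stratumE[OF S] by metis
  then obtain c where c: "c \<in> C" "x \<in> orbit G \<phi> c"
    using x by (auto simp: saturation_iff)
  have cX: "c \<in> topspace XM"
    using C c by blast
  have xX: "x \<in> topspace XM"
    using orbit_topspace[OF cX c(2)] .
  have "y \<in> orbit G \<phi> c"
    using orbit_trans[OF cX xX orbit_topspace[OF xX y] c(2) y] .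
  then show ?thesis
    using C(1) c(1) by (auto simp: saturation_iff)
qed

lemma point_in_stratum:
  assumes m: "m \<in> topspace XM"
  shows "\<exists>S\<in>strata. m \<in> S"
proof -
  let ?Y = "subtopology XM (isotropy (stab m))"
  let ?C = "connected_component_of_set ?Y m"
  have mY: "m \<in> topspace ?Y"
    using m by (simp add: isotropy_set_def)
  then have "?C \<in> connected_components_of ?Y"
    by (simp add: connected_components_of_def)
  then have "saturation G \<phi> ?C \<in> strata"
    using stabilizer_subgroup[OF m] closedin_stabilizer[OF m]
    unfolding orbit_type_strata_def by blast
  moreover have "m \<in> ?C"
    using mY by (simp add: connected_component_of_refl)
  then have "m \<in> saturation G \<phi> ?C"
    using orbit_refl[OF m] unfolding saturation_iff by blast
  ultimately show ?thesis by blast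
qed

lemma stab_translate_cong:
  assumes "x \<in> topspace XM" "y \<in> topspace XM" "g \<in> carrier G" "stab x = stab y"
  shows "stab (\<phi> g x) = stab (\<phi> g y)"
proof -
  have "h \<in> stab (\<phi> g x) \<longleftrightarrow> h \<in> stab (\<phi> g y)" for h
    using assms by (simp add: stabilizer_translate)
  then show ?thesis by blast
qed

text \<open>
  A translation \<phi> g that moves a point of the component D to one of C carries all of D into C,
  because it maps points with equal stabilizers to points with equal stabilizers and preserves
  connectedness.
\<close>

lemma stratum_subset_stratum:
  assumes S: "S \<in> strata" and T: "T \<in> strata" and x: "x \<in> S" "x \<in> T"
  shows "T \<subseteq> S"
proof -
  obtain H C where C: "C \<in> connected_components_of (subtopology XM (isotropy H))"
    "S = saturation G \<phi> C" "C \<subseteq> topspace XM" "\<And>c. c \<in> C \<Longrightarrow> stab c = H"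
    using stratumE[OF S] by metis
  obtain K D where D: "D \<in> connected_components_of (subtopology XM (isotropy K))"
    "T = saturation G \<phi> D" "D \<subseteq> topspace XM" "\<And>d. d \<in> D \<Longrightarrow> stab d = K"
    using stratumE[OF T] by metis
  obtain c d where cd: "c \<in> C" "x \<in> orbit G \<phi> c" "d \<in> D" "x \<in> orbit G \<phi> d"
    using x C(2) D(2) by (auto simp: saturation_iff)
  have cX: "c \<in> topspace XM" and dX: "d \<in> topspace XM"
    using cd C(3) D(3) by auto
  have xX: "x \<in> topspace XM"
    using orbit_topspace[OF cX cd(2)] .
  have "c \<in> orbit G \<phi> d"
    using orbit_trans[OF dX xX cX cd(4) orbit_sym[OF cX xX cd(2)]] .
  then obtain g where g: "g \<in> carrier G" "c = \<phi> g d"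
    by (auto simp: orbit_def)
  have "connectedin XM D"
    using connectedin_connected_components_of[OF D(1)] connectedin_subtopology by blast
  then have "connectedin XM (\<phi> g ` D)"
    by (rule connectedin_continuous_map_image[OF continuous_translation[OF g(1)]])
  moreover have "\<phi> g ` D \<subseteq> isotropy H"
  proof
    fix y assume "y \<in> \<phi> g ` D"
    then obtain d' where d': "d' \<in> D" "y = \<phi> g d'"
      by blast
    have d'X: "d' \<in> topspace XM"
      using d' D(3) by blast
    have "stab y = stab c"
      unfolding d'(2) g(2) using d'(1) cd(3) D(4)
      by (intro stab_translate_cong[OF d'X dX g(1)]) simp
    then show "y \<in> isotropy H"
      using action_closed[OF g(1) d'X] d'(2) C(4)[OF cd(1)] by (simp add: isotropy_set_def)
  qed
  ultimately have "connectedin (subtopology XM (isotropy H)) (\<phi> g ` D)"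
    by (simp add: connectedin_subtopology)
  moreover have "\<not> disjnt C (\<phi> g ` D)"
    using g(2) cd(1,3) unfolding disjnt_def by blast
  ultimately have gD: "\<phi> g ` D \<subseteq> C"
    by (rule connected_components_of_maximal[OF C(1)])
  show ?thesis
  proof
    fix y assume "y \<in> T"
    then obtain d' where d': "d' \<in> D" "y \<in> orbit G \<phi> d'"
      using D(2) by (auto simp: saturation_iff)
    have d'X: "d' \<in> topspace XM"
      using d' D(3) by blast
    note gd'X = action_closed[OF g(1) d'X]
    have "\<phi> g d' \<in> orbit G \<phi> d'"
      using g(1) by (auto simp: orbit_def)
    then have "d' \<in> orbit G \<phi> (\<phi> g d')"
      using orbit_sym[OF d'X gd'X] by blast
    then have "y \<in> orbit G \<phi> (\<phi> g d')"
      using orbit_trans[OF gd'X d'X orbit_topspace[OF d'X d'(2)] _ d'(2)] by blast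
    moreover have "\<phi> g d' \<in> C"
      using gD d'(1) by blast
    ultimately show "y \<in> S"
      unfolding C(2) saturation_iff by blast
  qed
qed

lemma stratum_eq:
  assumes "S \<in> strata" "T \<in> strata" "x \<in> S" "x \<in> T"
  shows "S = T"
  using stratum_subset_stratum assms by blast

text \<open>
  A stratum is the saturation of a set on which the stabilizer is constant, so any two of its
  points have conjugate stabilizers.
\<close>

lemma stratum_stabilizers_eq:
  assumes S: "S \<in> strata" and x: "x \<in> S" and y: "y \<in> S" and sub: "stab x \<subseteq> stab y"
  shows "stab y = stab x"
proof -
  obtain H C where C: "S = saturation G \<phi> C" "C \<subseteq> topspace XM" "\<And>c. c \<in> C \<Longrightarrow> stab c = H"
    using stratumE[OF S] by metis
  obtain c d where cd: "c \<in> C" "x \<in> orbit G \<phi> c" "d \<in> C" "y \<in> orbit G \<phi> d"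
    using x y C(1) by (auto simp: saturation_iff)
  have cX: "c \<in> topspace XM" and dX: "d \<in> topspace XM"
    using cd C(2) by auto
  have xX: "x \<in> topspace XM" and yX: "y \<in> topspace XM"
    using orbit_topspace[OF cX cd(2)] orbit_topspace[OF dX cd(4)] .
  obtain k where k: "k \<in> carrier G" "y = \<phi> k d"
    using cd(4) by (auto simp: orbit_def)
  have "\<phi> k c \<in> orbit G \<phi> c"
    using k(1) by (auto simp: orbit_def)
  then have z: "\<phi> k c \<in> orbit G \<phi> x"
    using orbit_trans[OF xX cX action_closed[OF k(1) cX] orbit_sym[OF cX xX cd(2)]] by blast
  have "stab (\<phi> k c) = stab y"
    unfolding k(2) using C(3) cd by (intro stab_translate_cong[OF cX dX k(1)]) simp
  from conjugate_stabilizers_eq[OF xX yX z this sub] show ?thesis .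
qed

lemma connected_isotropy_in_stratum:
  assumes S: "S \<in> strata" and P: "connectedin XM P" "\<And>y. y \<in> P \<Longrightarrow> stab y = stab x"
    and x: "x \<in> P" "x \<in> S"
  shows "P \<subseteq> S"
proof -
  let ?Y = "subtopology XM (isotropy (stab x))"
  let ?C = "connected_component_of_set ?Y x"
  have PX: "P \<subseteq> topspace XM"
    using P(1) connectedin_subset_topspace by blast
  then have "P \<subseteq> isotropy (stab x)"
    using P(2) by (auto simp: isotropy_set_def)
  then have "connectedin ?Y P"
    using P(1) by (simp add: connectedin_subtopology)
  then have PC: "P \<subseteq> ?C"
    using x(1) by (rule connected_component_of_maximal)
  have xX: "x \<in> topspace XM"
    using PX x by blast
  then have "x \<in> topspace ?Y"
    by (simp add: isotropy_set_def)
  then have "?C \<in> connected_components_of ?Y"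
    by (simp add: connected_components_of_def)
  then have T: "saturation G \<phi> ?C \<in> strata"
    using stabilizer_subgroup[OF xX] closedin_stabilizer[OF xX]
    unfolding orbit_type_strata_def by blast
  have sub: "P \<subseteq> saturation G \<phi> ?C"
  proof
    fix y assume "y \<in> P"
    then have "y \<in> ?C" "y \<in> orbit G \<phi> y"
      using PC PX orbit_refl by auto
    then show "y \<in> saturation G \<phi> ?C"
      unfolding saturation_iff by blast
  qed
  have "S = saturation G \<phi> ?C"
    by (rule stratum_eq[OF S T x(2) subsetD[OF sub x(1)]])
  with sub show ?thesis by simp
qed

section \<open>Homotopies and closed strata\<close>

text \<open>
  A point of the closure of S lies in some stratum T, and T \<noteq> S would be strictly below S.
\<close>

lemma minimal_stratum_closed:
  assumes "S \<in> minimal_strata G XG \<phi> XM"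
  shows "closedin XM S"
proof -
  have S: "S \<in> strata" and min: "\<And>T. T \<in> strata \<Longrightarrow> \<not> stratum_less XM T S"
    using assms unfolding minimal_strata_def by auto
  have "XM closure_of S \<subseteq> S"
  proof
    fix x assume x: "x \<in> XM closure_of S"
    then have "x \<in> topspace XM"
      by (metis in_closure_of)
    then obtain T where T: "T \<in> strata" "x \<in> T"
      using point_in_stratum by blast
    with min[OF T(1)] x have "T = S"
      unfolding stratum_less_def by blast
    with T show "x \<in> S" by simp
  qed
  then show ?thesis
    using closure_of_subset_eq stratum_topspace[OF S] by blast
qed

text \<open>
  The times spent in S form a closed set as S is closed. At such a time t0 the stabilizer equals
  the initial one; for t near t0 it contains the initial one and hence still equals it. So the
  path near t0 stays in one component of an isotropy set, and therefore in S.
\<close>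

lemma path_stays_in_stratum:
  assumes S: "S \<in> strata" and closed: "closedin XM S"
    and \<gamma>: "continuous_map (top_of_set {0..1::real}) XM \<gamma>" and start: "\<gamma> 0 \<in> S"
    and grow: "\<And>t. t \<in> {0..1} \<Longrightarrow> stab (\<gamma> 0) \<subseteq> stab (\<gamma> t)"
    and t: "t \<in> {0..1}"
  shows "\<gamma> t \<in> S"
proof -
  define T where "T = {t \<in> {0..1}. \<gamma> t \<in> S}"
  have \<gamma>X: "\<gamma> t \<in> topspace XM" if "t \<in> {0..1}" for t
    using continuous_map_image_subset_topspace[OF \<gamma>] that by auto
  have "closedin (top_of_set {0..1}) T"
    using closedin_continuous_map_preimage[OF \<gamma> closed] by (simp add: T_def)
  moreover have "openin (top_of_set {0..1}) T"
  proof (subst openin_subopen, intro ballI)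
    fix t0 assume t0: "t0 \<in> T"
    then have t01: "t0 \<in> {0..1}" and t0S: "\<gamma> t0 \<in> S"
      by (auto simp: T_def)
    have stab0: "stab (\<gamma> t0) = stab (\<gamma> 0)"
      by (rule stratum_stabilizers_eq[OF S start t0S grow[OF t01]])
    obtain W where W: "openin XM W" "\<gamma> t0 \<in> W"
      "\<And>x. x \<in> W \<Longrightarrow> stab (\<gamma> t0) \<subseteq> stab x \<Longrightarrow> stab x = stab (\<gamma> t0)"
      using stabilizer_locally_maximal[OF \<gamma>X[OF t01]] by blast
    have "openin (top_of_set {0..1}) {t \<in> {0..1}. \<gamma> t \<in> W}"
      using openin_continuous_map_preimage[OF \<gamma> W(1)] by simp
    then obtain e where e: "e > 0" "\<And>t. t \<in> {0..1} \<Longrightarrow> dist t t0 < e \<Longrightarrow> \<gamma> t \<in> W"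
      using t01 W(2) unfolding openin_euclidean_subtopology_iff by blast
    define I where "I = {0..1} \<inter> ball t0 e"
    have "connected I"
      unfolding I_def by (intro convex_connected convex_Int) auto
    then have "connectedin (top_of_set {0..1}) I"
      by (simp add: connectedin_subtopology I_def)
    then have "connectedin XM (\<gamma> ` I)"
      by (rule connectedin_continuous_map_image[OF \<gamma>])
    moreover have "stab y = stab (\<gamma> t0)" if "y \<in> \<gamma> ` I" for y
    proof -
      obtain t where t: "t \<in> {0..1}" "dist t t0 < e" "y = \<gamma> t"
        using \<open>y \<in> \<gamma> ` I\<close> by (auto simp: I_def dist_commute)
      have "stab (\<gamma> t0) \<subseteq> stab (\<gamma> t)"
        unfolding stab0 by (rule grow[OF t(1)])
      from W(3)[OF e(2)[OF t(1,2)] this] show ?thesis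
        unfolding t(3) .
    qed
    moreover have "\<gamma> t0 \<in> \<gamma> ` I"
      using t01 e(1) by (auto simp: I_def)
    ultimately have "\<gamma> ` I \<subseteq> S"
      by (rule connected_isotropy_in_stratum[OF S _ _ _ t0S])
    then have "I \<subseteq> T"
      by (auto simp: I_def T_def)
    moreover have "openin (top_of_set {0..1}) I" "t0 \<in> I"
      using t01 e(1) by (auto simp: I_def)
    ultimately show "\<exists>I. openin (top_of_set {0..1}) I \<and> t0 \<in> I \<and> I \<subseteq> T"
      by blast
  qed
  moreover have "connected {0..1::real}"
    by simp
  ultimately have "T = {} \<or> T = {0..1}"
    unfolding connected_clopen by blast
  moreover have "0 \<in> T"
    using start by (simp add: T_def)
  ultimately have "t \<in> T"
    using t by blast
  then show ?thesis
    by (simp add: T_def)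
qed

text \<open>
  Equivariance makes each g that fixes m also fix the path t \<mapsto> H (m, t), so stabilizers can
  only grow along it.
\<close>

lemma retraction_stays_in_stratum:
  assumes S: "S \<in> strata" "closedin XM S"
    and H: "G_deformation_retract G \<phi> XM U B H" and U: "U \<subseteq> topspace XM"
    and m: "m \<in> U" "m \<in> S" and t: "t \<in> {0..1}"
  shows "H (m, t) \<in> S"
proof (rule path_stays_in_stratum[OF S, of "\<lambda>t. H (m, t)"])
  have mX: "m \<in> topspace XM"
    using U m by blast
  have H0: "H (m, 0) = m"
    using H m unfolding G_deformation_retract_def by blast
  have "continuous_map (top_of_set {0..1}) (prod_topology (subtopology XM U) (top_of_set {0..1})) (\<lambda>t. (m, t))"
    using m mX by (intro continuous_map_pairedI) auto
  moreover have "continuous_map (prod_topology (subtopology XM U) (top_of_set {0..1})) (subtopology XM U) H"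
    using H unfolding G_deformation_retract_def by blast
  ultimately have "continuous_map (top_of_set {0..1}) (subtopology XM U) (H \<circ> (\<lambda>t. (m, t)))"
    by (rule continuous_map_compose)
  then show "continuous_map (top_of_set {0..1}) XM (\<lambda>t. H (m, t))"
    by (simp add: o_def continuous_map_in_subtopology)
  show "H (m, 0) \<in> S"
    using H0 m by simp
  fix t :: real assume t: "t \<in> {0..1}"
  show "stab (H (m, 0)) \<subseteq> stab (H (m, t))"
  proof
    fix g assume g: "g \<in> stab (H (m, 0))"
    then have g': "g \<in> carrier G" "\<phi> g m = m"
      by (auto simp: stabilizer_def H0)
    have "H (\<phi> g m, t) = \<phi> g (H (m, t))"
      using H g'(1) m(1) t unfolding G_deformation_retract_def by blast
    with g' show "g \<in> stab (H (m, t))"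
      by (simp add: stabilizer_def)
  qed
qed (rule t)

lemma center_in_stratum:
  assumes S: "S \<in> strata" "closedin XM S"
    and H: "G_deformation_retract G \<phi> XM U (orbit G \<phi> x) H" and U: "U \<subseteq> topspace XM" and x: "x \<in> U"
    and m: "m \<in> U" "m \<in> S"
  shows "x \<in> S"
proof -
  have "H (m, 1) \<in> S"
    by (rule retraction_stays_in_stratum[OF S H U m]) simp
  moreover have "H (m, 1) \<in> orbit G \<phi> x"
    using H m(1) unfolding G_deformation_retract_def by blast
  moreover have "x \<in> topspace XM" "H (m, 1) \<in> topspace XM"
    using x U calculation orbit_topspace by blast+
  ultimately show ?thesis
    using stratum_orbit[OF S(1)] orbit_sym by blast
qed

lemma categorical_restrict:
  assumes S: "S \<in> strata" "closedin XM S"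
    and inv: "G_invariant G \<phi> U"
    and H: "G_deformation_retract G \<phi> XM U (orbit G \<phi> x) H" and U: "U \<subseteq> topspace XM" and x: "x \<in> U"
    and xS: "x \<in> S"
  shows "G_categorical G \<phi> (subtopology XM S) (U \<inter> S)"
proof -
  let ?I = "top_of_set {0..1::real}"
  let ?US = "subtopology XM (U \<inter> S)"
  have stay: "H (m, t) \<in> S" if "m \<in> U \<inter> S" "t \<in> {0..1}" for m t
    using retraction_stays_in_stratum[OF S H U] that by blast
  have cont: "continuous_map (prod_topology (subtopology XM U) ?I) (subtopology XM U) H"
    using H unfolding G_deformation_retract_def by blast
  have eq: "prod_topology ?US ?I = subtopology (prod_topology (subtopology XM U) ?I) ((U \<inter> S) \<times> {0..1})"
    by (simp add: subtopology_Times subtopology_subtopology)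
  have "continuous_map (prod_topology ?US ?I) (subtopology XM U) H"
    unfolding eq by (rule continuous_map_from_subtopology[OF cont])
  then have "continuous_map (prod_topology ?US ?I) XM H" "H \<in> topspace (prod_topology ?US ?I) \<rightarrow> U"
    by (auto simp: continuous_map_in_subtopology)
  then have "continuous_map (prod_topology ?US ?I) ?US H"
    using stay by (auto simp: continuous_map_in_subtopology)
  moreover have "subtopology (subtopology XM S) (U \<inter> S) = ?US"
    by (simp add: subtopology_subtopology Int_commute Int_left_commute)
  ultimately have "G_deformation_retract G \<phi> (subtopology XM S) (U \<inter> S) (orbit G \<phi> x) H"
    using H unfolding G_deformation_retract_def by auto
  moreover have "G_invariant G \<phi> (U \<inter> S)"
    using inv stratum_orbit[OF S(1)] unfolding G_invariant_def orbit_def by blast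
  ultimately show ?thesis
    using x xS U unfolding G_categorical_def by auto
qed

section \<open>Counting members of a categorical cover\<close>

text \<open>
  The members of the cover whose orbit lies in S restrict to a categorical cover of S, and for
  distinct S these families are disjoint. In particular only finitely many minimal strata exist,
  so that the infinite sum is a finite one.
\<close>

lemma sum_Cat_G_le_card_cover:
  assumes fin: "finite \<U>" and open_cat: "\<And>U. U \<in> \<U> \<Longrightarrow> openin XM U \<and> G_categorical G \<phi> XM U"
    and cover: "\<Union>\<U> = topspace XM"
  shows "(\<Sum>\<^sub>\<infinity>S\<in>minimal_strata G XG \<phi> XM. Cat_G G \<phi> (subtopology XM S)) \<le> enat (card \<U>)"
proof -
  let ?M = "minimal_strata G XG \<phi> XM"
  have M: "S \<in> strata" "closedin XM S" if "S \<in> ?M" for S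
    using that minimal_stratum_closed by (auto simp: minimal_strata_def)
  have "\<forall>U\<in>\<U>. \<exists>x. x \<in> U \<and> (\<exists>H. G_deformation_retract G \<phi> XM U (orbit G \<phi> x) H)"
    using open_cat unfolding G_categorical_def by blast
  then obtain c where c: "\<And>U. U \<in> \<U> \<Longrightarrow> c U \<in> U"
    "\<And>U. U \<in> \<U> \<Longrightarrow> \<exists>H. G_deformation_retract G \<phi> XM U (orbit G \<phi> (c U)) H"
    by metis
  have U: "U \<subseteq> topspace XM" "G_invariant G \<phi> U" if "U \<in> \<U>" for U
    using open_cat[OF that] unfolding G_categorical_def by auto
  define \<V> where "\<V> S = {U \<in> \<U>. c U \<in> S}" for S
  have finV: "finite (\<V> S)" for S
    using fin by (simp add: \<V>_def)
  have meets: "U \<in> \<V> S" if "S \<in> ?M" "U \<in> \<U>" "m \<in> U" "m \<in> S" for S U m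
    using center_in_stratum[OF M[OF that(1)] _ U(1)[OF that(2)] c(1)[OF that(2)] that(3,4)] c(2)[OF that(2)] that(2)
    by (auto simp: \<V>_def)
  have Cat_le: "Cat_G G \<phi> (subtopology XM S) \<le> enat (card (\<V> S))" if S: "S \<in> ?M" for S
  proof -
    let ?W = "(\<lambda>U. U \<inter> S) ` \<V> S"
    have SX: "S \<subseteq> topspace XM"
      using stratum_topspace M(1) S by blast
    have 1: "openin (subtopology XM S) (U \<inter> S)" if "U \<in> \<V> S" for U
      using that open_cat by (auto simp: \<V>_def openin_subtopology)
    have 2: "G_categorical G \<phi> (subtopology XM S) (U \<inter> S)" if "U \<in> \<V> S" for U
    proof -
      have U': "U \<in> \<U>" "c U \<in> S"
        using that by (auto simp: \<V>_def)
      then obtain H where "G_deformation_retract G \<phi> XM U (orbit G \<phi> (c U)) H"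
        using c(2) by blast
      from categorical_restrict[OF M[OF S] U(2)[OF U'(1)] this U(1)[OF U'(1)] c(1)[OF U'(1)] U'(2)]
      show ?thesis .
    qed
    have "\<Union>?W = S"
    proof
      show "S \<subseteq> \<Union>?W"
      proof
        fix m assume m: "m \<in> S"
        then obtain U where "U \<in> \<U>" "m \<in> U"
          using SX cover by blast
        with meets[OF S this m] m show "m \<in> \<Union>?W"
          by blast
      qed
    qed auto
    then have "Cat_G G \<phi> (subtopology XM S) \<le> enat (card ?W)"
      unfolding Cat_G_def using 1 2 finV SX
      by (intro Inf_lower CollectI exI[of _ ?W]) (auto simp: Int_absorb1)
    also have "\<dots> \<le> enat (card (\<V> S))"
      by (simp add: card_image_le[OF finV])
    finally show ?thesis .
  qed
  have disj: "\<V> S \<inter> \<V> T = {}" if "S \<in> ?M" "T \<in> ?M" "S \<noteq> T" for S T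
    using stratum_eq[OF M(1)[OF that(1)] M(1)[OF that(2)]] that(3) by (auto simp: \<V>_def)
  have "?M \<subseteq> (\<lambda>U. THE S. S \<in> strata \<and> c U \<in> S) ` \<U>"
  proof
    fix S assume S: "S \<in> ?M"
    obtain m where m: "m \<in> S"
      using stratum_nonempty M(1)[OF S] by blast
    then obtain U where U': "U \<in> \<U>" "m \<in> U"
      using stratum_topspace M(1)[OF S] cover by blast
    then have "c U \<in> S"
      using meets[OF S U' m] by (simp add: \<V>_def)
    then have "(THE S. S \<in> strata \<and> c U \<in> S) = S"
    proof (intro the_equality conjI)
      fix T assume "T \<in> strata \<and> c U \<in> T"
      with \<open>c U \<in> S\<close> show "T = S"
        using stratum_eq M(1)[OF S] by metis
    qed (rule M(1)[OF S])
    from this[symmetric] U'(1)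
    show "S \<in> (\<lambda>U. THE S. S \<in> strata \<and> c U \<in> S) ` \<U>"
      by (rule image_eqI)
  qed
  then have finM: "finite ?M"
    using fin finite_surj by blast
  have "(\<Sum>\<^sub>\<infinity>S\<in>?M. Cat_G G \<phi> (subtopology XM S)) = (\<Sum>S\<in>?M. Cat_G G \<phi> (subtopology XM S))"
    by (rule infsum_finite[OF finM])
  also have "\<dots> \<le> (\<Sum>S\<in>?M. enat (card (\<V> S)))"
    by (rule sum_mono[OF Cat_le])
  also have "\<dots> = enat (\<Sum>S\<in>?M. card (\<V> S))"
    by (simp flip: of_nat_eq_enat)
  also have "(\<Sum>S\<in>?M. card (\<V> S)) = card (\<Union>S\<in>?M. \<V> S)"
    using finM finV disj by (intro card_UN_disjoint[symmetric]) auto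
  also have "enat \<dots> \<le> enat (card \<U>)"
    using fin by (auto intro!: card_mono simp: \<V>_def)
  finally show ?thesis .
qed

end

theorem theorem5p1:
  fixes VG :: "'e::euclidean_space set" and XG :: "'g topology" and AG :: "('g, 'e) chart set"
    and G :: "('g, 'r) monoid_scheme"
    and VM :: "'f::euclidean_space set" and XM :: "'m topology" and AM :: "('m, 'f) chart set"
    and \<phi> :: "'g \<Rightarrow> 'm \<Rightarrow> 'm"
  assumes "proper_G_manifold VG XG AG G VM XM AM \<phi>"
  shows "Cat_G G \<phi> XM \<ge> (\<Sum>\<^sub>\<infinity>S\<in>minimal_strata G XG \<phi> XM. Cat_G G \<phi> (subtopology XM S))"
proof -
  interpret proper_G_manifold VG XG AG G VM XM AM \<phi>
    by fact
  show ?thesis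
    unfolding Cat_G_def[of G \<phi> XM]
    by (intro Inf_greatest) (auto intro!: sum_Cat_G_le_card_cover)
qed
end
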